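(* Let $\psi:\Sigma\to\mathbb{R}^3$ be an affine maxface on a Riemann surface $\Sigma$, and let $d\sigma^2$ be the Euclidean first fundamental form of its conormal map. If $\psi$ is complete, then the metric $d\sigma^2$ is complete.
   Context: Notation: $[\cdot,\cdot,\cdot]$ is the determinant of three vectors and $\times$ the cross product in $\mathbb{R}^3$, both extended complex-multilinearly to $\mathbb{C}^3$. Affine maximal map: let $\Sigma$ be a Riemann surface with universal cover $\tilde\Sigma$. A map $\psi:\Sigma\to\mathbb{R}^3$ is an affine maximal map if there is a holomorphic map $\Phi:\tilde\Sigma\to\mathbb{C}^3$, with $N:=\Phi+\overline{\Phi}$ single-valued on $\Sigma$, such that $[\Phi+\overline{\Phi},d\Phi,\overline{d\Phi}]\not\equiv0$ and $\psi=2\,\mathrm{Re}\left(i\int(\Phi+\overline{\Phi})\times d\Phi\right)$ (single-valued on $\Sigma$). $N$ is the conormal map, and $h=-2i[\Phi+\overline{\Phi},d\Phi,\overline{d\Phi}]$ (locally $-2i[\Phi+\overline\Phi,\Phi_z,\overline{\Phi_z}]\,|dz|^2$) the affine metric. Affine maxface: an affine maximal map whose conormal map $N:\Sigma\to\mathbb{R}^3$ is a Euclidean conformal minimal immersion. If $d\sigma^2$ is the first fundamental form and $\nu$ the unit normal of $N$, then $h=\langle N,\nu\rangle\,d\sigma^2$. Complete: $\psi$ is complete if there is a symmetric $(0,2)$-tensor $T$ with compact support such that $|h|+T$ is a complete Riemannian metric on $\Sigma$ (locally $|h|=|a|\,|dz|^2$ if $h=a|dz|^2$). *)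

theory Defs
  imports "HOL-Analysis.Analysis"
begin

section \<open>Riemann surfaces\<close>

text \<open>
  A Riemann surface is a (Hausdorff) type together with a holomorphic atlas.  A chart is a pair
  of its domain and its coordinate map; the coordinate map is irrelevant outside the domain.
\<close>

type_synonym 'a chart = "'a set \<times> ('a \<Rightarrow> complex)"

definition chart_inv :: "'a chart \<Rightarrow> complex \<Rightarrow> 'a" where
  "chart_inv c = inv_into (fst c) (snd c)"

definition is_chart :: "'a::t2_space chart \<Rightarrow> bool" where
  "is_chart c \<longleftrightarrow> open (fst c) \<and> open (snd c ` fst c) \<and>
     homeomorphism (fst c) (snd c ` fst c) (snd c) (chart_inv c)"

definition riemann_surface :: "'a::t2_space chart set \<Rightarrow> bool" where
  "riemann_surface A \<longleftrightarrow>
     connected (UNIV :: 'a set) \<and>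
     (\<forall>c\<in>A. is_chart c) \<and> (\<Union>c\<in>A. fst c) = UNIV \<and>
     (\<forall>c\<in>A. \<forall>c'\<in>A. (snd c' \<circ> chart_inv c) holomorphic_on (snd c ` (fst c \<inter> fst c')))"

text \<open>
  Used only for quantities that do not depend on the choice of the chart.
\<close>

definition chart_at :: "'a chart set \<Rightarrow> 'a \<Rightarrow> 'a chart" where
  "chart_at A p = (SOME c. c \<in> A \<and> p \<in> fst c)"

definition holomorphic_map ::
    "'a::t2_space chart set \<Rightarrow> 'b::t2_space chart set \<Rightarrow> ('a \<Rightarrow> 'b) \<Rightarrow> bool" where
  "holomorphic_map A B f \<longleftrightarrow> continuous_on UNIV f \<and>
     (\<forall>c\<in>A. \<forall>c'\<in>B. (snd c' \<circ> f \<circ> chart_inv c) holomorphic_on (snd c ` (fst c \<inter> f -` fst c')))"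

text \<open>The complex derivative of a map between Riemann surfaces in given charts.\<close>

definition map_deriv :: "'a chart \<Rightarrow> 'b chart \<Rightarrow> ('a \<Rightarrow> 'b) \<Rightarrow> 'a \<Rightarrow> complex" where
  "map_deriv c c' f p = deriv (snd c' \<circ> f \<circ> chart_inv c) (snd c p)"

definition universal_cover ::
    "'a::t2_space chart set \<Rightarrow> 'b::t2_space chart set \<Rightarrow> ('b \<Rightarrow> 'a) \<Rightarrow> bool" where
  "universal_cover A B \<pi> \<longleftrightarrow>
     riemann_surface B \<and> simply_connected (UNIV :: 'b set) \<and>
     covering_space UNIV \<pi> UNIV \<and> holomorphic_map B A \<pi>"

section \<open>Curves, tensors, Riemannian metrics\<close>

text \<open>
  One-sided derivatives are required at the end points of the closed subintervals, so that the
  velocity of a piecewise \<open>C\<^sup>1\<close> curve is bounded in charts.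
\<close>

definition C1_curve_on :: "'a::t2_space chart set \<Rightarrow> real \<Rightarrow> real \<Rightarrow> (real \<Rightarrow> 'a) \<Rightarrow> bool" where
  "C1_curve_on A a b \<gamma> \<longleftrightarrow>
     (\<forall>c\<in>A. \<exists>D. continuous_on {t\<in>{a..b}. \<gamma> t \<in> fst c} D \<and>
        (\<forall>t\<in>{a..b}. \<gamma> t \<in> fst c \<longrightarrow>
           ((snd c \<circ> \<gamma>) has_vector_derivative D t) (at t within {a..b})))"

definition piecewise_C1_curve :: "'a::t2_space chart set \<Rightarrow> (real \<Rightarrow> 'a) \<Rightarrow> bool" where
  "piecewise_C1_curve A \<gamma> \<longleftrightarrow> path \<gamma> \<and>
     (\<exists>S. finite S \<and>
        (\<forall>a b. 0 \<le> a \<and> a < b \<and> b \<le> 1 \<and> {a<..<b} \<inter> S = {} \<longrightarrow> C1_curve_on A a b \<gamma>))"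

definition velocity :: "'a chart \<Rightarrow> (real \<Rightarrow> 'a) \<Rightarrow> real \<Rightarrow> complex" where
  "velocity c \<gamma> t = vector_derivative (snd c \<circ> \<gamma>) (at t)"

text \<open>
  Tensors are given by their components in the charts of the atlas: \<open>T c p v w\<close> is the value at
  \<open>p\<close> on the tangent vectors with coordinates \<open>v\<close>, \<open>w\<close> in the chart \<open>c\<close>, where
  the real tangent space is identified with the complex plane.
\<close>

type_synonym 'a tensor = "'a chart \<Rightarrow> 'a \<Rightarrow> complex \<Rightarrow> complex \<Rightarrow> real"

definition symmetric_tensor :: "'a::t2_space chart set \<Rightarrow> 'a tensor \<Rightarrow> bool" where
  "symmetric_tensor A T \<longleftrightarrow>
     (\<forall>c\<in>A. \<forall>p\<in>fst c. bilinear (T c p) \<and> (\<forall>v w. T c p v w = T c p w v)) \<and>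
     (\<forall>c\<in>A. \<forall>c'\<in>A. \<forall>p\<in>fst c \<inter> fst c'. \<forall>v w.
        T c p v w = T c' p (map_deriv c c' id p * v) (map_deriv c c' id p * w))"

definition compactly_supported :: "'a::t2_space chart set \<Rightarrow> 'a tensor \<Rightarrow> bool" where
  "compactly_supported A T \<longleftrightarrow>
     compact (closure {p. \<exists>c\<in>A. p \<in> fst c \<and> (\<exists>v w. T c p v w \<noteq> 0)})"

text \<open>
  Riemannian metrics are only required to be continuous: where an affine metric vanishes,
  its absolute value need not be differentiable.
\<close>

definition riemannian_metric :: "'a::t2_space chart set \<Rightarrow> 'a tensor \<Rightarrow> bool" where
  "riemannian_metric A g \<longleftrightarrow> symmetric_tensor A g \<and>
     (\<forall>c\<in>A. (\<forall>v w. continuous_on (fst c) (\<lambda>p. g c p v w)) \<and>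
             (\<forall>p\<in>fst c. \<forall>v. v \<noteq> 0 \<longrightarrow> g c p v v > 0))"

definition curve_length :: "'a chart set \<Rightarrow> 'a tensor \<Rightarrow> (real \<Rightarrow> 'a) \<Rightarrow> real" where
  "curve_length A g \<gamma> = integral {0..1}
     (\<lambda>t. let c = chart_at A (\<gamma> t); v = velocity c \<gamma> t in sqrt (g c (\<gamma> t) v v))"

definition riemannian_dist :: "'a::t2_space chart set \<Rightarrow> 'a tensor \<Rightarrow> 'a \<Rightarrow> 'a \<Rightarrow> real" where
  "riemannian_dist A g p q =
     (INF \<gamma>\<in>{\<gamma>. piecewise_C1_curve A \<gamma> \<and> \<gamma> 0 = p \<and> \<gamma> 1 = q}. curve_length A g \<gamma>)"

definition complete_riemannian_metric :: "'a::t2_space chart set \<Rightarrow> 'a tensor \<Rightarrow> bool" where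
  "complete_riemannian_metric A g \<longleftrightarrow>
     riemannian_metric A g \<and> Metric_space.mcomplete UNIV (riemannian_dist A g)"

section \<open>Vector algebra in complex 3-space\<close>

definition cvec :: "real^3 \<Rightarrow> complex^3" where
  "cvec v = (\<chi> i. complex_of_real (v $ i))"

definition vcnj :: "complex^3 \<Rightarrow> complex^3" where
  "vcnj v = (\<chi> i. cnj (v $ i))"

definition vRe :: "complex^3 \<Rightarrow> real^3" where
  "vRe v = (\<chi> i. Re (v $ i))"

definition ccross3 :: "complex^3 \<Rightarrow> complex^3 \<Rightarrow> complex^3" where
  "ccross3 a b = vector [a$2 * b$3 - a$3 * b$2, a$3 * b$1 - a$1 * b$3, a$1 * b$2 - a$2 * b$1]"

definition det3 :: "complex^3 \<Rightarrow> complex^3 \<Rightarrow> complex^3 \<Rightarrow> complex" where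
  "det3 a b c = det (vector [a, b, c] :: complex^3^3)"

section \<open>Affine maximal maps\<close>

definition holomorphic_C3 :: "'b::t2_space chart set \<Rightarrow> ('b \<Rightarrow> complex^3) \<Rightarrow> bool" where
  "holomorphic_C3 B \<Phi> \<longleftrightarrow>
     (\<forall>c\<in>B. \<forall>i. (\<lambda>z. \<Phi> (chart_inv c z) $ i) holomorphic_on (snd c ` fst c))"

text \<open>The derivative \<open>\<Phi>\<^sub>z\<close> with respect to the coordinate \<open>z = snd c\<close>.\<close>

definition C3_deriv :: "'b chart \<Rightarrow> ('b \<Rightarrow> complex^3) \<Rightarrow> 'b \<Rightarrow> complex^3" where
  "C3_deriv c \<Phi> x = (\<chi> i. deriv (\<lambda>z. \<Phi> (chart_inv c z) $ i) (snd c x))"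

text \<open>The integral of the form \<open>(\<Phi> + cnj \<Phi>) \<times> d\<Phi>\<close> along a curve.\<close>

definition conormal_integral ::
    "'b chart set \<Rightarrow> ('b \<Rightarrow> complex^3) \<Rightarrow> (real \<Rightarrow> 'b) \<Rightarrow> complex^3" where
  "conormal_integral B \<Phi> \<gamma> = integral {0..1}
     (\<lambda>t. let c = chart_at B (\<gamma> t) in
        ccross3 (\<Phi> (\<gamma> t) + vcnj (\<Phi> (\<gamma> t))) (velocity c \<gamma> t *s C3_deriv c \<Phi> (\<gamma> t)))"

text \<open>The coefficient of \<open>|dz|\<^sup>2\<close> in the affine metric with respect to \<open>z = snd c\<close>.\<close>

definition affine_coeff :: "'b chart \<Rightarrow> ('b \<Rightarrow> complex^3) \<Rightarrow> 'b \<Rightarrow> complex" where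
  "affine_coeff c \<Phi> x =
     - 2 * \<i> * det3 (\<Phi> x + vcnj (\<Phi> x)) (C3_deriv c \<Phi> x) (vcnj (C3_deriv c \<Phi> x))"

text \<open>
  The affine maximal map \<open>\<psi>\<close> with holomorphic data \<open>\<Phi>\<close> on the universal cover and conormal map
  \<open>N\<close>.  As usual, the primitive is determined up to a translation, and since only the real part
  of \<open>\<i> (\<Phi> + cnj \<Phi>) \<times> d\<Phi>\<close> is closed, the real part is taken of the integral along each curve
  from the base point.
\<close>

definition affine_maximal_map ::
    "'a::t2_space chart set \<Rightarrow> 'b::t2_space chart set \<Rightarrow> ('b \<Rightarrow> 'a) \<Rightarrow>
     ('b \<Rightarrow> complex^3) \<Rightarrow> ('a \<Rightarrow> real^3) \<Rightarrow> ('a \<Rightarrow> real^3) \<Rightarrow> bool" where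
  "affine_maximal_map A B \<pi> \<Phi> N \<psi> \<longleftrightarrow>
     holomorphic_C3 B \<Phi> \<and>
     (\<forall>x. cvec (N (\<pi> x)) = \<Phi> x + vcnj (\<Phi> x)) \<and>
     (\<exists>c\<in>B. \<exists>x\<in>fst c. det3 (\<Phi> x + vcnj (\<Phi> x)) (C3_deriv c \<Phi> x) (vcnj (C3_deriv c \<Phi> x)) \<noteq> 0) \<and>
     (\<exists>x0 b. \<forall>\<gamma>. piecewise_C1_curve B \<gamma> \<and> \<gamma> 0 = x0 \<longrightarrow>
        \<psi> (\<pi> (\<gamma> 1)) = b + 2 *\<^sub>R vRe (\<i> *s conormal_integral B \<Phi> \<gamma>))"

text \<open>
  \<open>|dz|\<^sup>2\<close> is the bilinear form \<open>(v, w) \<mapsto> Re (v * cnj w)\<close>.  The affine metric is the tensor on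
  the surface whose pullback to the universal cover is \<open>-2\<i>[\<Phi> + cnj \<Phi>, d\<Phi>, cnj d\<Phi>]\<close>; this
  determines it uniquely.  The coefficient is a real number.
\<close>

definition is_affine_metric ::
    "'a::t2_space chart set \<Rightarrow> 'b::t2_space chart set \<Rightarrow> ('b \<Rightarrow> 'a) \<Rightarrow>
     ('b \<Rightarrow> complex^3) \<Rightarrow> 'a tensor \<Rightarrow> bool" where
  "is_affine_metric A B \<pi> \<Phi> h \<longleftrightarrow> symmetric_tensor A h \<and>
     (\<forall>c\<in>B. \<forall>c'\<in>A. \<forall>x\<in>fst c. \<pi> x \<in> fst c' \<longrightarrow>
        (\<forall>v w. h c' (\<pi> x) (map_deriv c c' \<pi> x * v) (map_deriv c c' \<pi> x * w)
               = Re (affine_coeff c \<Phi> x) * Re (v * cnj w)))"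

text \<open>If \<open>h = a |dz|\<^sup>2\<close> then \<open>a = h(1,1)\<close> and \<open>|h| = |a| |dz|\<^sup>2\<close>.\<close>

definition abs_tensor :: "'a tensor \<Rightarrow> 'a tensor" where
  "abs_tensor h c p v w = \<bar>h c p 1 1\<bar> * Re (v * cnj w)"

text \<open>Completeness of the affine maximal map with data \<open>\<Phi>\<close>.\<close>

definition complete_affine_map ::
    "'a::t2_space chart set \<Rightarrow> 'b::t2_space chart set \<Rightarrow> ('b \<Rightarrow> 'a) \<Rightarrow> ('b \<Rightarrow> complex^3) \<Rightarrow> bool" where
  "complete_affine_map A B \<pi> \<Phi> \<longleftrightarrow>
     (\<exists>h T. is_affine_metric A B \<pi> \<Phi> h \<and> symmetric_tensor A T \<and> compactly_supported A T \<and>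
        complete_riemannian_metric A (\<lambda>c p v w. abs_tensor h c p v w + T c p v w))"

section \<open>Conformal minimal immersions and affine maxfaces\<close>

primrec Ck_on :: "nat \<Rightarrow> complex set \<Rightarrow> (complex \<Rightarrow> real^3) \<Rightarrow> bool" where
  "Ck_on 0 S f \<longleftrightarrow> continuous_on S f"
| "Ck_on (Suc k) S f \<longleftrightarrow>
     f differentiable_on S \<and> (\<forall>v. Ck_on k S (\<lambda>z. frechet_derivative f (at z) v))"

definition surface_deriv :: "'a chart \<Rightarrow> ('a \<Rightarrow> real^3) \<Rightarrow> 'a \<Rightarrow> complex \<Rightarrow> real^3" where
  "surface_deriv c N p v = frechet_derivative (N \<circ> chart_inv c) (at (snd c p)) v"

definition first_fundamental_form :: "('a \<Rightarrow> real^3) \<Rightarrow> 'a tensor" where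
  "first_fundamental_form N c p v w = surface_deriv c N p v \<bullet> surface_deriv c N p w"

definition unit_normal :: "'a chart \<Rightarrow> ('a \<Rightarrow> real^3) \<Rightarrow> 'a \<Rightarrow> real^3" where
  "unit_normal c N p =
     (let n = cross3 (surface_deriv c N p 1) (surface_deriv c N p \<i>) in n /\<^sub>R norm n)"

definition second_fundamental_form :: "('a \<Rightarrow> real^3) \<Rightarrow> 'a tensor" where
  "second_fundamental_form N c p v w =
     frechet_derivative (\<lambda>z. frechet_derivative (N \<circ> chart_inv c) (at z) v) (at (snd c p)) w
       \<bullet> unit_normal c N p"

definition mean_curvature :: "'a chart \<Rightarrow> ('a \<Rightarrow> real^3) \<Rightarrow> 'a \<Rightarrow> real" where
  "mean_curvature c N p =
     (let I = first_fundamental_form N c p; II = second_fundamental_form N c p in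
      (II 1 1 * I \<i> \<i> - 2 * II 1 \<i> * I 1 \<i> + II \<i> \<i> * I 1 1) /
      (2 * (I 1 1 * I \<i> \<i> - (I 1 \<i>)\<^sup>2)))"

definition conformal_minimal_immersion ::
    "'a::t2_space chart set \<Rightarrow> ('a \<Rightarrow> real^3) \<Rightarrow> bool" where
  "conformal_minimal_immersion A N \<longleftrightarrow>
     (\<forall>c\<in>A. (\<forall>k. Ck_on k (snd c ` fst c) (N \<circ> chart_inv c)) \<and>
        (\<forall>p\<in>fst c.
           inj (surface_deriv c N p) \<and>
           (\<exists>r>0. \<forall>v w. first_fundamental_form N c p v w = r * Re (v * cnj w)) \<and>
           mean_curvature c N p = 0))"

definition affine_maxface ::
    "'a::t2_space chart set \<Rightarrow> 'b::t2_space chart set \<Rightarrow> ('b \<Rightarrow> 'a) \<Rightarrow>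
     ('b \<Rightarrow> complex^3) \<Rightarrow> ('a \<Rightarrow> real^3) \<Rightarrow> ('a \<Rightarrow> real^3) \<Rightarrow> bool" where
  "affine_maxface A B \<pi> \<Phi> N \<psi> \<longleftrightarrow>
     affine_maximal_map A B \<pi> \<Phi> N \<psi> \<and> conformal_minimal_immersion A N"

end

theory Submission
  imports Defs "HOL-Complex_Analysis.Conformal_Mappings"
begin

text \<open>
  Since \<open>h = \<langle>N, \<nu>\<rangle> d\<sigma>\<^sup>2\<close>, we have \<open>|h| \<le> |N| d\<sigma>\<^sup>2\<close>, and \<open>N\<close> is 1-Lipschitz for \<open>d\<sigma>\<^sup>2\<close>.  Hence \<open>N\<close> is
  bounded along curves of bounded \<open>d\<sigma>\<^sup>2\<close>-length, and off the support of \<open>T\<close> such curves are at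
  most a constant factor longer for \<open>|h| + T\<close> than for \<open>d\<sigma>\<^sup>2\<close>.
\<close>

section \<open>Charts\<close>

text \<open>Since \<open>|N|\<close> may be unbounded, there need not be one constant comparing
  \<open>|h|\<close> with the first fundamental form on the whole surface. The comparison is
  therefore made for one Cauchy sequence at a time: its tail stays within distance 1 of one of its
  members, and this bounds \<open>N\<close> on all short curves between late members. Completeness
  is \<open>mcomplete\<close> for an infimum of real lengths. For an arbitrary continuous Riemannian
  metric this infimum has to be shown to be a genuine distance inducing the given topology, because
  the limit is found for one metric and needed for the other. Two default values have to be excluded
  on the way: \<open>integral\<close> is 0 on non-integrable functions, and the infimum over an
  empty set of curves is unspecified. The bound on \<open>|h|\<close> is computed on the universal
  cover. With \<Phi>_z = a + i b the affine coefficient is -4 <N, a x b>, while conformality makes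
  4|a|^2 = 4|b|^2 the factor of the pulled-back first fundamental form.\<close>

lemma chart_inv_chart [simp]: "is_chart c \<Longrightarrow> p \<in> fst c \<Longrightarrow> chart_inv c (snd c p) = p"
  unfolding is_chart_def homeomorphism_def by auto

lemma chart_chart_inv [simp]: "is_chart c \<Longrightarrow> z \<in> snd c ` fst c \<Longrightarrow> snd c (chart_inv c z) = z"
  unfolding is_chart_def homeomorphism_def by auto

lemma chart_inv_mem: "is_chart c \<Longrightarrow> z \<in> snd c ` fst c \<Longrightarrow> chart_inv c z \<in> fst c"
  unfolding is_chart_def homeomorphism_def by auto

lemma chart_continuous: "is_chart c \<Longrightarrow> continuous_on (fst c) (snd c)"
  unfolding is_chart_def homeomorphism_def by auto

lemma chart_inv_continuous: "is_chart c \<Longrightarrow> continuous_on (snd c ` fst c) (chart_inv c)"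
  unfolding is_chart_def homeomorphism_def by auto

lemma chart_open: "is_chart c \<Longrightarrow> open (fst c)" "is_chart c \<Longrightarrow> open (snd c ` fst c)"
  unfolding is_chart_def by auto

lemma open_chart_image:
  assumes c: "is_chart c" and U: "open U" "U \<subseteq> fst c"
  shows "open (snd c ` U)"
proof -
  have eq: "snd c ` U = snd c ` fst c \<inter> chart_inv c -` U"
    using c U chart_inv_chart[OF c] by (force simp: image_iff)
  show ?thesis
    unfolding eq using chart_inv_continuous[OF c] chart_open(2)[OF c] U(1)
    by (simp add: continuous_open_preimage)
qed

lemma open_chart_inv_image:
  assumes c: "is_chart c" and V: "open V" "V \<subseteq> snd c ` fst c"
  shows "open (chart_inv c ` V)"
proof -
  have eq: "chart_inv c ` V = fst c \<inter> snd c -` V"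
  proof (intro equalityI subsetI)
    fix p assume "p \<in> chart_inv c ` V"
    then show "p \<in> fst c \<inter> snd c -` V"
      using V chart_inv_mem[OF c] chart_chart_inv[OF c] by auto
  next
    fix p assume "p \<in> fst c \<inter> snd c -` V"
    then show "p \<in> chart_inv c ` V"
      using chart_inv_chart[OF c, of p] by (metis IntD1 IntD2 image_eqI vimageD)
  qed
  show ?thesis
    unfolding eq using chart_continuous[OF c] chart_open(1)[OF c] V(1)
    by (simp add: continuous_open_preimage)
qed

lemma riemann_surface_chart: "riemann_surface A \<Longrightarrow> c \<in> A \<Longrightarrow> is_chart c"
  unfolding riemann_surface_def by blast

lemma riemann_surface_cover: "riemann_surface A \<Longrightarrow> \<exists>c\<in>A. p \<in> fst c"
  unfolding riemann_surface_def by blast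

lemma chart_at:
  assumes "riemann_surface A"
  shows "chart_at A p \<in> A" "p \<in> fst (chart_at A p)"
  using someI_ex[of "\<lambda>c. c \<in> A \<and> p \<in> fst c"] riemann_surface_cover[OF assms, of p]
  unfolding chart_at_def by blast+

lemma transition_holomorphic:
  assumes A: "riemann_surface A" and c: "c \<in> A" "c' \<in> A"
  shows "(snd c' \<circ> chart_inv c) holomorphic_on snd c ` (fst c \<inter> fst c')"
    and "open (snd c ` (fst c \<inter> fst c'))"
  using A c open_chart_image[of c "fst c \<inter> fst c'"] chart_open[of c] chart_open[of c']
  unfolding riemann_surface_def by (blast, auto)

lemma transition_has_derivative:
  assumes A: "riemann_surface A" and c: "c \<in> A" "c' \<in> A" and p: "p \<in> fst c" "p \<in> fst c'"
  shows "((snd c' \<circ> chart_inv c) has_field_derivative map_deriv c c' id p) (at (snd c p))"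
  using holomorphic_derivI[OF transition_holomorphic[OF A c]] p
  unfolding map_deriv_def by auto

section \<open>Piecewise C1 curves\<close>

text \<open>\<open>velocity\<close> is a choice-based derivative that has a value even where none
  exists; this predicate says that it is the true two-sided derivative in every chart at \<gamma> t.
  Continuity is included so that the curve stays in a chart around \<open>t\<close>.\<close>

definition smooth_at :: "'a::t2_space chart set \<Rightarrow> (real \<Rightarrow> 'a) \<Rightarrow> real \<Rightarrow> bool" where
  "smooth_at A \<gamma> t \<longleftrightarrow> isCont \<gamma> t \<and>
     (\<forall>c\<in>A. \<gamma> t \<in> fst c \<longrightarrow> ((snd c \<circ> \<gamma>) has_vector_derivative velocity c \<gamma> t) (at t))"

text \<open>The chain rule in the form shared by subpaths, reversed curves and both halves of a
  join: \<open>m\<close> may be negative, and the curves need to agree only on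
  \<open>{a..b}\<close>.\<close>

lemma C1_curve_on_affine:
  assumes C1: "C1_curve_on A a' b' \<gamma>"
    and sub: "\<And>t. t \<in> {a..b} \<Longrightarrow> m * t + k \<in> {a'..b'}"
    and eq: "\<And>t. t \<in> {a..b} \<Longrightarrow> \<gamma>' t = \<gamma> (m * t + k)"
  shows "C1_curve_on A a b \<gamma>'"
  unfolding C1_curve_on_def
proof
  fix c assume "c \<in> A"
  then obtain D where D: "continuous_on {t\<in>{a'..b'}. \<gamma> t \<in> fst c} D"
    and D': "\<And>t. t \<in> {a'..b'} \<Longrightarrow> \<gamma> t \<in> fst c \<Longrightarrow>
              ((snd c \<circ> \<gamma>) has_vector_derivative D t) (at t within {a'..b'})"
    using C1 unfolding C1_curve_on_def by blast
  let ?D = "\<lambda>t. m *\<^sub>R D (m * t + k)"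
  have "continuous_on {t\<in>{a..b}. \<gamma>' t \<in> fst c} ?D"
    by (intro continuous_intros continuous_on_compose2[OF D]) (use sub eq in auto)
  moreover have "((snd c \<circ> \<gamma>') has_vector_derivative ?D t) (at t within {a..b})"
    if t: "t \<in> {a..b}" "\<gamma>' t \<in> fst c" for t
  proof -
    have 1: "((\<lambda>t. m * t + k) has_vector_derivative m) (at t within {a..b})"
      by (auto intro!: derivative_eq_intros)
    have 2: "((snd c \<circ> \<gamma>) has_vector_derivative D (m * t + k))
        (at (m * t + k) within (\<lambda>t. m * t + k) ` {a..b})"
      by (rule has_vector_derivative_within_subset[OF D']) (use sub eq t in auto)
    show ?thesis
      by (rule has_vector_derivative_transform[OF t(1) _ vector_diff_chain_within[OF 1 2]])
        (use eq in auto)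
  qed
  ultimately show "\<exists>D. continuous_on {t \<in> {a..b}. \<gamma>' t \<in> fst c} D \<and>
      (\<forall>t\<in>{a..b}. \<gamma>' t \<in> fst c \<longrightarrow>
        ((snd c \<circ> \<gamma>') has_vector_derivative D t) (at t within {a..b}))"
    by blast
qed

text \<open>The break points pull back to a finite set because the affine map is injective, hence
  \<open>u \<noteq> v\<close>. The case \<open>v < u\<close> is allowed, so reversal is
  included.\<close>

lemma piecewise_C1_subpath:
  assumes "piecewise_C1_curve A \<gamma>" "u \<in> {0..1}" "v \<in> {0..1}" "u \<noteq> v"
  shows "piecewise_C1_curve A (\<lambda>t. \<gamma> ((v - u) * t + u))"
proof -
  obtain S where S: "finite S" and
    C: "\<And>a b. 0 \<le> a \<Longrightarrow> a < b \<Longrightarrow> b \<le> 1 \<Longrightarrow> {a<..<b} \<inter> S = {} \<Longrightarrow> C1_curve_on A a b \<gamma>"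
    and "path \<gamma>"
    using assms(1) unfolding piecewise_C1_curve_def by blast
  define m where "m = v - u"
  have m: "m \<noteq> 0" using assms by (simp add: m_def)
  let ?S = "(\<lambda>x. m * x + u) -` S"
  have fin: "finite ?S"
    by (rule finite_vimageI[OF S]) (use m in \<open>auto simp: inj_def\<close>)
  have rng: "m * x + u \<in> {0..1}" if "x \<in> {0..1}" for x
  proof -
    have "m * x + u = (1 - x) * u + x * v" by (simp add: m_def algebra_simps)
    then show ?thesis
      using convexD[OF convex_real_interval(5)[of 0 1] assms(2,3), of "1 - x" x] that by auto
  qed
  have "C1_curve_on A a b (\<lambda>t. \<gamma> ((v - u) * t + u))" if ab: "0 \<le> a" "a < b" "b \<le> 1" "{a<..<b} \<inter> ?S = {}" for a b
  proof -
    define a' b' where "a' = min (m * a + u) (m * b + u)" and "b' = max (m * a + u) (m * b + u)"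
    have im: "{a'..b'} = (\<lambda>x. m * x + u) ` {a..b}"
      using ab unfolding image_affinity_atLeastAtMost a'_def b'_def min_def max_def
      by (auto simp: mult_le_cancel_left)
    have ab': "a' < b'" using ab m by (auto simp: a'_def b'_def min_def max_def)
    have e: "a' \<in> {0..1}" "b' \<in> {0..1}"
      using rng[of a] rng[of b] ab by (auto simp: a'_def b'_def min_def max_def)
    have "{a'<..<b'} \<inter> S = {}"
    proof (rule equals0I)
      fix y assume y: "y \<in> {a'<..<b'} \<inter> S"
      then have "y \<in> {a'..b'}" by auto
      then obtain x where x: "x \<in> {a..b}" "y = m * x + u" unfolding im by auto
      have "x \<noteq> a" "x \<noteq> b" using y x by (auto simp: a'_def b'_def)
      then have "x \<in> {a<..<b} \<inter> ?S" using x y by auto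
      then show False using ab by blast
    qed
    then have C': "C1_curve_on A a' b' \<gamma>" using C e ab' by auto
    show ?thesis
      by (rule C1_curve_on_affine[OF C', of _ _ m u]) (use im in \<open>auto simp: m_def\<close>)
  qed
  moreover have "path (\<lambda>t. \<gamma> ((v - u) * t + u))"
    unfolding path_def m_def[symmetric]
    by (rule continuous_on_compose2[OF \<open>path \<gamma>\<close>[unfolded path_def]])
      (use rng in \<open>auto intro!: continuous_intros\<close>)
  ultimately show ?thesis
    unfolding piecewise_C1_curve_def using fin by blast
qed

lemma piecewise_C1_join:
  assumes "piecewise_C1_curve A \<gamma>1" "piecewise_C1_curve A \<gamma>2" and eq: "\<gamma>1 1 = \<gamma>2 0"
  shows "piecewise_C1_curve A (\<gamma>1 +++ \<gamma>2)"
proof -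
  obtain S where S: "finite S" and
    C: "\<And>a b. 0 \<le> a \<Longrightarrow> a < b \<Longrightarrow> b \<le> 1 \<Longrightarrow> {a<..<b} \<inter> S = {} \<Longrightarrow> C1_curve_on A a b \<gamma>1"
    and p1: "path \<gamma>1"
    using assms(1) unfolding piecewise_C1_curve_def by blast
  obtain S' where S': "finite S'" and
    C': "\<And>a b. 0 \<le> a \<Longrightarrow> a < b \<Longrightarrow> b \<le> 1 \<Longrightarrow> {a<..<b} \<inter> S' = {} \<Longrightarrow> C1_curve_on A a b \<gamma>2"
    and p2: "path \<gamma>2"
    using assms(2) unfolding piecewise_C1_curve_def by blast
  let ?S = "{1/2} \<union> (*) 2 -` S \<union> (\<lambda>x. 2 * x - 1) -` S'"
  have fin: "finite ?S"
    by (auto intro!: finite_vimageI[OF S] finite_vimageI[OF S'] simp: inj_def)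
  have "C1_curve_on A a b (\<gamma>1 +++ \<gamma>2)" if ab: "0 \<le> a" "a < b" "b \<le> 1" "{a<..<b} \<inter> ?S = {}" for a b
  proof -
    have "1/2 \<notin> {a<..<b}" using ab by auto
    then consider "b \<le> 1/2" | "1/2 \<le> a" by fastforce
    then show ?thesis
    proof cases
      case 1
      have "{2*a<..<2*b} \<inter> S = {}"
      proof (rule equals0I)
        fix y assume "y \<in> {2*a<..<2*b} \<inter> S"
        then have "y/2 \<in> {a<..<b} \<inter> ?S" by auto
        then show False using ab by blast
      qed
      then have "C1_curve_on A (2*a) (2*b) \<gamma>1" using C ab 1 by auto
      then show ?thesis
        by (rule C1_curve_on_affine[of _ _ _ _ _ _ 2 0]) (use 1 in \<open>auto simp: joinpaths_def\<close>)
    next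
      case 2
      have "{2*a-1<..<2*b-1} \<inter> S' = {}"
      proof (rule equals0I)
        fix y assume "y \<in> {2*a-1<..<2*b-1} \<inter> S'"
        then have "(y+1)/2 \<in> {a<..<b} \<inter> ?S" by (auto simp: add_divide_distrib)
        then show False using ab by blast
      qed
      then have C2: "C1_curve_on A (2*a-1) (2*b-1) \<gamma>2" using C' ab 2 by auto
      \<comment> \<open>At \<open>t = 1/2\<close> the join takes its value from
        \<open>\<gamma>1\<close>; there the formula holds because the end points match.\<close>
      have *: "(\<gamma>1 +++ \<gamma>2) t = \<gamma>2 (2 * t + -1)" if "t \<in> {a..b}" for t
      proof (cases "t = 1/2")
        case True
        then show ?thesis using eq by (simp only: joinpaths_def) simp
      next
        case False
        then have "\<not> t \<le> 1/2" using 2 that by auto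
        then show ?thesis by (simp add: joinpaths_def)
      qed
      show ?thesis
        by (rule C1_curve_on_affine[where m = 2 and k = "-1", OF C2 _ *]) auto
    qed
  qed
  moreover have "path (\<gamma>1 +++ \<gamma>2)"
    using p1 p2 eq by (simp add: pathfinish_def pathstart_def)
  ultimately show ?thesis
    unfolding piecewise_C1_curve_def by (intro conjI exI[of _ ?S] fin allI impI) auto
qed

lemma C1_curve_on_smooth_at:
  assumes C1: "C1_curve_on A a b \<gamma>" and cont: "isCont \<gamma> t" and t: "a < t" "t < b"
  shows "smooth_at A \<gamma> t"
proof -
  have at: "at t within {a..b} = at t"
    by (rule at_within_interior) (use t in simp)
  have "((snd c \<circ> \<gamma>) has_vector_derivative velocity c \<gamma> t) (at t)"
    if c: "c \<in> A" "\<gamma> t \<in> fst c" for c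
  proof -
    have "t \<in> {a..b}" using t by simp
    then obtain D where "((snd c \<circ> \<gamma>) has_vector_derivative D) (at t within {a..b})"
      using C1 c unfolding C1_curve_on_def by blast
    then have "((snd c \<circ> \<gamma>) has_vector_derivative D) (at t)" unfolding at .
    then show ?thesis
      unfolding velocity_def by (metis vector_derivative_at)
  qed
  with cont show ?thesis unfolding smooth_at_def by blast
qed

lemma piecewise_C1_smooth_at:
  assumes "piecewise_C1_curve A \<gamma>"
  obtains S where "finite S" "\<And>t. t \<in> {0..1} - S \<Longrightarrow> smooth_at A \<gamma> t"
proof -
  obtain S where S: "finite S" and
    C: "\<And>a b. 0 \<le> a \<Longrightarrow> a < b \<Longrightarrow> b \<le> 1 \<Longrightarrow> {a<..<b} \<inter> S = {} \<Longrightarrow> C1_curve_on A a b \<gamma>"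
    and p: "path \<gamma>"
    using assms unfolding piecewise_C1_curve_def by blast
  \<comment> \<open>\<open>smooth_at\<close> is two-sided, while the curve is controlled only on
    \<open>{0..1}\<close>; so 0 and 1 join the exceptional set.\<close>
  have "smooth_at A \<gamma> t" if t: "t \<in> {0..1} - insert 0 (insert 1 S)" for t
  proof -
    have "open ({0<..<1} - S)" using S by (simp add: finite_imp_closed open_Diff)
    moreover have "t \<in> {0<..<1} - S" using t by auto
    ultimately obtain e where e: "e > 0" "cball t e \<subseteq> {0<..<1} - S"
      using open_contains_cball by blast
    have int: "{t-e..t+e} \<subseteq> {0<..<1} - S"
      using e by (simp add: cball_eq_atLeastAtMost)
    moreover have "{t-e<..<t+e} \<subseteq> {t-e..t+e}" by auto
    ultimately have "{t-e<..<t+e} \<inter> S = {}" by blast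
    moreover have "t - e \<in> {t-e..t+e}" "t + e \<in> {t-e..t+e}" using e(1) by auto
    then have "t - e \<in> {0<..<1}" "t + e \<in> {0<..<1}" using int by blast+
    ultimately have C1: "C1_curve_on A (t-e) (t+e) \<gamma>"
      using C[of "t-e" "t+e"] e(1) by auto
    have "isCont \<gamma> t"
      using p t continuous_on_interior[of "{0..1}" \<gamma> t] by (auto simp: path_def)
    then show ?thesis using C1_curve_on_smooth_at[OF C1] e(1) by simp
  qed
  then show ?thesis using S that[of "insert 0 (insert 1 S)"] by auto
qed

text \<open>Chain rule for the transition map, applicable since the curve stays in
  \<open>fst c\<close> near \<open>t\<close>. Together with the tensor law it makes the speed
  independent of the chart.\<close>

lemma smooth_at_velocity_change:
  assumes A: "riemann_surface A" and c: "c \<in> A" "c' \<in> A" and s: "smooth_at A \<gamma> t"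
    and t: "\<gamma> t \<in> fst c" "\<gamma> t \<in> fst c'"
  shows "velocity c' \<gamma> t = map_deriv c c' id (\<gamma> t) * velocity c \<gamma> t"
proof -
  have ch: "is_chart c" using A c riemann_surface_chart by blast
  have 1: "((snd c \<circ> \<gamma>) has_vector_derivative velocity c \<gamma> t) (at t)"
    using s c t unfolding smooth_at_def by blast
  have 2: "((snd c' \<circ> chart_inv c) has_field_derivative map_deriv c c' id (\<gamma> t)) (at ((snd c \<circ> \<gamma>) t))"
    using transition_has_derivative[OF A c t] by simp
  have ev: "\<forall>\<^sub>F x in nhds t. \<gamma> x \<in> fst c"
    using s topological_tendstoD[OF _ chart_open(1)[OF ch] t(1)]
    unfolding smooth_at_def isCont_def tendsto_at_iff_tendsto_nhds by blast
  have "((snd c' \<circ> chart_inv c \<circ> (snd c \<circ> \<gamma>)) has_vector_derivative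
      velocity c \<gamma> t * map_deriv c c' id (\<gamma> t)) (at t)"
    by (rule field_vector_diff_chain_at[OF 1 2])
  moreover have "\<forall>\<^sub>F x in nhds t. x \<in> UNIV \<longrightarrow> (snd c' \<circ> chart_inv c \<circ> (snd c \<circ> \<gamma>)) x = (snd c' \<circ> \<gamma>) x"
    using ev by eventually_elim (simp add: ch)
  ultimately have "((snd c' \<circ> \<gamma>) has_vector_derivative
      velocity c \<gamma> t * map_deriv c c' id (\<gamma> t)) (at t)"
    by (subst (asm) has_vector_derivative_cong_ev) (use ch t(1) in auto)
  then show ?thesis unfolding velocity_def by (simp add: vector_derivative_at mult.commute)
qed

lemma smooth_at_affine:
  assumes s: "smooth_at A \<gamma> (m * t + k)" and ev: "\<forall>\<^sub>F x in nhds t. \<gamma>' x = \<gamma> (m * x + k)"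
  shows "smooth_at A \<gamma>' t"
    and "c \<in> A \<Longrightarrow> \<gamma>' t \<in> fst c \<Longrightarrow> velocity c \<gamma>' t = m *\<^sub>R velocity c \<gamma> (m * t + k)"
proof -
  have eq: "\<gamma>' t = \<gamma> (m * t + k)" using ev by (rule eventually_nhds_x_imp_x)
  have D: "((snd c \<circ> \<gamma>') has_vector_derivative m *\<^sub>R velocity c \<gamma> (m * t + k)) (at t)"
    if "c \<in> A" "\<gamma>' t \<in> fst c" for c
  proof -
    have 1: "((\<lambda>t. m * t + k) has_vector_derivative m) (at t)"
      by (auto intro!: derivative_eq_intros)
    have 2: "((snd c \<circ> \<gamma>) has_vector_derivative velocity c \<gamma> (m * t + k)) (at (m * t + k))"
      using s that eq unfolding smooth_at_def by auto
    have e: "\<forall>\<^sub>F x in nhds t. x \<in> UNIV \<longrightarrow> (snd c \<circ> \<gamma>') x = (snd c \<circ> \<gamma> \<circ> (\<lambda>t. m * t + k)) x"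
      using ev by eventually_elim simp
    show ?thesis
      using vector_diff_chain_at[OF 1 2] has_vector_derivative_cong_ev[OF e] eq by (simp add: o_def)
  qed
  then show "c \<in> A \<Longrightarrow> \<gamma>' t \<in> fst c \<Longrightarrow> velocity c \<gamma>' t = m *\<^sub>R velocity c \<gamma> (m * t + k)"
    unfolding velocity_def[of _ \<gamma>'] by (simp add: vector_derivative_at)
  with D have D': "((snd c \<circ> \<gamma>') has_vector_derivative velocity c \<gamma>' t) (at t)"
    if "c \<in> A" "\<gamma>' t \<in> fst c" for c
    using that unfolding velocity_def[of _ \<gamma>'] by (metis vector_derivative_at)
  have "isCont (\<lambda>x. \<gamma> (m * x + k)) t"
    using s unfolding smooth_at_def by (intro isCont_o2[where g = \<gamma> and f = "\<lambda>x. m * x + k"]) auto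
  then have "isCont \<gamma>' t" using isCont_cong[OF ev] by simp
  with D' show "smooth_at A \<gamma>' t" unfolding smooth_at_def by blast
qed

section \<open>Lengths and distances\<close>

locale riemannian_surface =
  fixes A :: "'a::t2_space chart set" and g :: "'a tensor"
  assumes surface: "riemann_surface A" and metric: "riemannian_metric A g"
begin

section \<open>The metric as a quadratic form in charts\<close>

lemmas chart = riemann_surface_chart[OF surface]

lemma g_tensor: "symmetric_tensor A g"
  using metric unfolding riemannian_metric_def by blast

lemma g_bilinear: "c \<in> A \<Longrightarrow> p \<in> fst c \<Longrightarrow> bilinear (g c p)"
  using g_tensor unfolding symmetric_tensor_def by blast

lemma g_commute: "c \<in> A \<Longrightarrow> p \<in> fst c \<Longrightarrow> g c p v w = g c p w v"
  using g_tensor unfolding symmetric_tensor_def by blast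

lemma g_change: "c \<in> A \<Longrightarrow> c' \<in> A \<Longrightarrow> p \<in> fst c \<Longrightarrow> p \<in> fst c' \<Longrightarrow>
    g c p v w = g c' p (map_deriv c c' id p * v) (map_deriv c c' id p * w)"
  using conjunct2[OF g_tensor[unfolded symmetric_tensor_def]] by (meson IntI)

lemma g_continuous: "c \<in> A \<Longrightarrow> continuous_on (fst c) (\<lambda>p. g c p v w)"
  using metric unfolding riemannian_metric_def by blast

lemma g_pos: "c \<in> A \<Longrightarrow> p \<in> fst c \<Longrightarrow> v \<noteq> 0 \<Longrightarrow> g c p v v > 0"
  using metric unfolding riemannian_metric_def by blast

lemma g_scaleR: "c \<in> A \<Longrightarrow> p \<in> fst c \<Longrightarrow> g c p (m *\<^sub>R v) (m *\<^sub>R v) = m\<^sup>2 * g c p v v"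
  by (simp add: bilinear_lmul[OF g_bilinear] bilinear_rmul[OF g_bilinear] power2_eq_square
      del: complex_scaleR scaleR_conv_of_real)

lemma g_nonneg: "c \<in> A \<Longrightarrow> p \<in> fst c \<Longrightarrow> g c p v v \<ge> 0"
  using g_pos[of c p v] g_scaleR[of c p 0 v] by (cases "v = 0") (auto intro: less_imp_le)

lemma g_expand:
  assumes "c \<in> A" "p \<in> fst c"
  shows "g c p v v = (Re v)\<^sup>2 * g c p 1 1 + 2 * Re v * Im v * g c p 1 \<i> + (Im v)\<^sup>2 * g c p \<i> \<i>"
proof -
  have v: "v = Re v *\<^sub>R 1 + Im v *\<^sub>R \<i>" by (simp add: complex_eq_iff)
  note b = g_bilinear[OF assms]
  show ?thesis
    by (subst (1 2) v)
      (simp add: bilinear_ladd[OF b] bilinear_radd[OF b] bilinear_lmul[OF b] bilinear_rmul[OF b]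
        g_commute[OF assms, of \<i> 1] power2_eq_square algebra_simps del: complex_scaleR)
qed

text \<open>A Riemannian metric is given as continuous in the base point for fixed vectors only.
  Expanding in the basis 1, i reduces joint continuity to this.\<close>

lemma continuous_on_g:
  assumes "c \<in> A" "continuous_on X p" "continuous_on X w" "p ` X \<subseteq> fst c"
  shows "continuous_on X (\<lambda>t. g c (p t) (w t) (w t))"
proof -
  have 1: "continuous_on X (\<lambda>t. g c (p t) v w)" for v w
    using continuous_on_compose2[OF g_continuous[OF assms(1)] assms(2,4)] .
  have "continuous_on X (\<lambda>t. (Re (w t))\<^sup>2 * g c (p t) 1 1 + 2 * Re (w t) * Im (w t) * g c (p t) 1 \<i>
      + (Im (w t))\<^sup>2 * g c (p t) \<i> \<i>)"
    by (intro continuous_intros 1 assms)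
  then show ?thesis
    by (rule continuous_on_eq) (use assms in \<open>auto simp: g_expand[symmetric]\<close>)
qed

section \<open>Speed, its integrability, and increments along curves\<close>

definition speed :: "(real \<Rightarrow> 'a) \<Rightarrow> real \<Rightarrow> real" where
  "speed \<gamma> t = (let c = chart_at A (\<gamma> t); v = velocity c \<gamma> t in sqrt (g c (\<gamma> t) v v))"

lemma curve_length_eq: "curve_length A g \<gamma> = integral {0..1} (speed \<gamma>)"
  by (simp add: curve_length_def speed_def[abs_def])

lemma speed_nonneg: "speed \<gamma> t \<ge> 0"
  unfolding speed_def Let_def by (rule real_sqrt_ge_zero[OF g_nonneg[OF chart_at[OF surface]]])

text \<open>The chart picked by \<open>chart_at\<close> may jump arbitrarily with \<open>t\<close>.
  At smooth times the transformation laws of tensor and velocity cancel, so a fixed chart can be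
  used on a whole interval.\<close>

lemma speed_chart:
  assumes "smooth_at A \<gamma> t" "c \<in> A" "\<gamma> t \<in> fst c"
  shows "speed \<gamma> t = sqrt (g c (\<gamma> t) (velocity c \<gamma> t) (velocity c \<gamma> t))"
proof -
  note ca = chart_at[OF surface, of "\<gamma> t"]
  show ?thesis
    unfolding speed_def Let_def
    using g_change[OF ca(1) assms(2) ca(2) assms(3)]
      smooth_at_velocity_change[OF surface ca(1) assms(2,1) ca(2) assms(3)] by simp
qed

lemma C1_speed_integrable:
  assumes C1: "C1_curve_on A a b \<gamma>" and cont: "continuous_on {a..b} \<gamma>"
    and c: "c \<in> A" "\<gamma> ` {a..b} \<subseteq> fst c"
  shows "speed \<gamma> integrable_on {a..b}"
proof -
  obtain D where D: "continuous_on {t\<in>{a..b}. \<gamma> t \<in> fst c} D"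
    and D': "\<And>t. t \<in> {a..b} \<Longrightarrow> \<gamma> t \<in> fst c \<Longrightarrow>
              ((snd c \<circ> \<gamma>) has_vector_derivative D t) (at t within {a..b})"
    using C1 c(1) unfolding C1_curve_on_def by blast
  have eq: "{t\<in>{a..b}. \<gamma> t \<in> fst c} = {a..b}" using c by auto
  have int: "(\<lambda>t. sqrt (g c (\<gamma> t) (D t) (D t))) integrable_on {a..b}"
    using D unfolding eq
    by (intro integrable_continuous_interval continuous_intros continuous_on_g c cont)
  show ?thesis
  \<comment> \<open>At \<open>a\<close> and \<open>b\<close> the two-sided \<open>velocity\<close>
    may differ from the one-sided derivative \<open>D\<close>; two points do not affect
    integrability.\<close>
  proof (rule integrable_spike_finite[OF _ _ int])
    fix t assume t: "t \<in> {a..b} - {a,b}"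
    then have tc: "\<gamma> t \<in> fst c" using c by auto
    have at: "at t within {a..b} = at t"
      by (rule at_within_interior) (use t in auto)
    have "isCont \<gamma> t"
      using cont t continuous_on_interior[of "{a..b}" \<gamma> t] by auto
    then have s: "smooth_at A \<gamma> t" by (rule C1_curve_on_smooth_at[OF C1]) (use t in auto)
    have "velocity c \<gamma> t = D t"
      unfolding velocity_def by (rule vector_derivative_at) (use D'[OF _ tc] t at in auto)
    then show "speed \<gamma> t = sqrt (g c (\<gamma> t) (D t) (D t))"
      using speed_chart[OF s c(1) tc] by simp
  qed simp
qed

text \<open>Integrability only has to be checked on small intervals around each point, and these fit
  into a single chart. Without it the length of a curve would be a meaningless default
  value.\<close>

lemma speed_integrable:
  assumes "piecewise_C1_curve A \<gamma>"
  shows "speed \<gamma> integrable_on {0..1}"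
proof -
  obtain S where S: "finite S" and
    C: "\<And>a b. 0 \<le> a \<Longrightarrow> a < b \<Longrightarrow> b \<le> 1 \<Longrightarrow> {a<..<b} \<inter> S = {} \<Longrightarrow> C1_curve_on A a b \<gamma>"
    and p: "path \<gamma>"
    using assms unfolding piecewise_C1_curve_def by blast
  have cont: "continuous_on {0..1} \<gamma>" using p by (simp add: path_def)
  have "speed \<gamma> integrable_on cbox 0 1"
  proof (rule integrable_on_little_subintervals, rule ballI)
    fix x :: real assume x: "x \<in> cbox 0 1"
    define c where "c = chart_at A (\<gamma> x)"
    have c: "c \<in> A" "\<gamma> x \<in> fst c" using chart_at[OF surface] unfolding c_def by auto
    have "open (fst c)" using chart chart_open c by blast
    then obtain U where U: "open U" "U \<inter> {0..1} = \<gamma> -` fst c \<inter> {0..1}"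
      using cont unfolding continuous_on_open_invariant by blast
    \<comment> \<open>All break points other than \<open>x\<close> are removed, so a small interval
      around \<open>x\<close> becomes free of interior break points once it is split at
      \<open>x\<close>.\<close>
    have "open (U \<inter> - (S - {x}))" using U S by (intro open_Int open_Compl finite_imp_closed) auto
    moreover have "x \<in> U \<inter> - (S - {x})" using U x c by auto
    ultimately obtain d where d: "d > 0" "ball x d \<subseteq> U \<inter> - (S - {x})"
      using open_contains_ball by blast
    have "speed \<gamma> integrable_on cbox u v"
      if uv: "x \<in> cbox u v" "cbox u v \<subseteq> ball x d" "cbox u v \<subseteq> cbox 0 1" for u v
    proof -
      have 0: "speed \<gamma> integrable_on {s..t}" if st: "{s..t} \<subseteq> {u..v}" "x \<notin> {s<..<t}" "s \<le> t" for s t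
      proof (cases "s < t")
        case True
        have "{s..t} \<subseteq> cbox u v" using st(1) by (simp only: box_real)
        then have sub: "{s..t} \<subseteq> U \<inter> - (S - {x})" "{s..t} \<subseteq> {0..1}"
          using uv(2,3) d(2) unfolding box_real by blast+
        then have "\<gamma> ` {s..t} \<subseteq> fst c" using U by auto
        moreover have "{s<..<t} \<subseteq> {s..t}" by auto
        then have "{s<..<t} \<inter> S = {}" using sub st(2) by blast
        then have "C1_curve_on A s t \<gamma>" using C[OF _ True] sub True by auto
        ultimately show ?thesis
          using C1_speed_integrable c continuous_on_subset[OF cont sub(2)] by blast
      next
        case False
        then have "{s..t} = cbox t t" using st(3) by auto
        then show ?thesis by (metis integrable_on_refl)
      qed
      have "speed \<gamma> integrable_on {u..x}" "speed \<gamma> integrable_on {x..v}"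
        by (rule 0; use uv(1) in auto)+
      then show ?thesis
        using Henstock_Kurzweil_Integration.integrable_combine[of u x v "speed \<gamma>"] uv by auto
    qed
    then show "\<exists>d>0. \<forall>u v. x \<in> cbox u v \<and> cbox u v \<subseteq> ball x d \<and> cbox u v \<subseteq> cbox 0 1 \<longrightarrow>
        speed \<gamma> integrable_on cbox u v"
      using d(1) by blast
  qed
  then show ?thesis by simp
qed

lemma speed_integral_le_curve_length:
  assumes "piecewise_C1_curve A \<gamma>" "0 \<le> s" "s \<le> 1"
  shows "speed \<gamma> integrable_on {0..s}" "integral {0..s} (speed \<gamma>) \<le> curve_length A g \<gamma>"
proof -
  note i = speed_integrable[OF assms(1)]
  show 1: "speed \<gamma> integrable_on {0..s}"
    by (rule integrable_on_subinterval[OF i]) (use assms in auto)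
  show "integral {0..s} (speed \<gamma>) \<le> curve_length A g \<gamma>"
    unfolding curve_length_eq
    by (rule integral_subset_le[OF _ 1 i]) (use assms speed_nonneg in auto)
qed

lemma curve_length_nonneg: "piecewise_C1_curve A \<gamma> \<Longrightarrow> curve_length A g \<gamma> \<ge> 0"
  unfolding curve_length_eq by (rule integral_nonneg[OF speed_integrable]) (auto simp: speed_nonneg)

text \<open>Fundamental theorem of calculus with finitely many exceptions, followed by the pointwise
  bound under the integral. \<open>F\<close> is general because the lemma is applied both to chart
  coordinates and to the map \<open>F\<close> of \<open>complete_comparison\<close>; the time
  \<open>s\<close> allows stopping while the curve is still inside a chart.\<close>

lemma increment_le_curve_length:
  fixes F :: "'a \<Rightarrow> 'e::euclidean_space"
  assumes \<gamma>: "piecewise_C1_curve A \<gamma>" and s: "0 \<le> s" "s \<le> 1" and C: "C \<ge> 0"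
    and cont: "continuous_on {0..s} (F \<circ> \<gamma>)"
    and deriv: "\<And>t. 0 < t \<Longrightarrow> t < s \<Longrightarrow> smooth_at A \<gamma> t \<Longrightarrow>
      \<exists>D. ((F \<circ> \<gamma>) has_vector_derivative D) (at t) \<and> norm D \<le> C * speed \<gamma> t"
  shows "norm (F (\<gamma> s) - F (\<gamma> 0)) \<le> C * curve_length A g \<gamma>"
proof -
  obtain S where S: "finite S" "\<And>t. t \<in> {0..1} - S \<Longrightarrow> smooth_at A \<gamma> t"
    using piecewise_C1_smooth_at[OF \<gamma>] by blast
  have "\<exists>D. \<forall>t. t \<in> {0<..<s} - S \<longrightarrow>
      ((F \<circ> \<gamma>) has_vector_derivative D t) (at t) \<and> norm (D t) \<le> C * speed \<gamma> t"
  proof (rule choice, rule allI)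
    fix t
    show "\<exists>D. t \<in> {0<..<s} - S \<longrightarrow>
      ((F \<circ> \<gamma>) has_vector_derivative D) (at t) \<and> norm D \<le> C * speed \<gamma> t"
      using deriv[of t] S(2)[of t] s by (cases "t \<in> {0<..<s} - S") auto
  qed
  then obtain D where D: "\<And>t. t \<in> {0<..<s} - S \<Longrightarrow> ((F \<circ> \<gamma>) has_vector_derivative D t) (at t)"
    "\<And>t. t \<in> {0<..<s} - S \<Longrightarrow> norm (D t) \<le> C * speed \<gamma> t" by blast
  \<comment> \<open>Extension by zero makes the bound by \<open>C * speed \<gamma> t\<close> valid
    at every \<open>t\<close>, since the right-hand side is nonnegative.\<close>
  define D' where "D' t = (if t \<in> {0<..<s} - S then D t else 0)" for t
  have int: "(D' has_integral ((F \<circ> \<gamma>) s - (F \<circ> \<gamma>) 0)) {0..s}"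
  proof (rule fundamental_theorem_of_calculus_interior_strong[OF S(1) s(1) _ cont])
    fix t assume t: "t \<in> {0<..<s} - S"
    then have "D' t = D t" unfolding D'_def by (rule if_P)
    with D(1)[OF t] show "((F \<circ> \<gamma>) has_vector_derivative D' t) (at t)" by (simp only:)
  qed
  note sp = speed_integral_le_curve_length[OF \<gamma> s]
  have "norm (integral {0..s} D') \<le> integral {0..s} (\<lambda>t. C * speed \<gamma> t)"
  proof (rule integral_norm_bound_integral)
    show "(\<lambda>t. C * speed \<gamma> t) integrable_on {0..s}"
      using integrable_cmul[OF sp(1), of C] by simp
    show "norm (D' t) \<le> C * speed \<gamma> t" for t
      using D(2)[of t] C speed_nonneg[of \<gamma> t] by (auto simp: D'_def)
  qed (use int in auto)
  also have "\<dots> = C * integral {0..s} (speed \<gamma>)" by simp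
  also have "\<dots> \<le> C * curve_length A g \<gamma>" using sp(2) C by (rule mult_left_mono)
  finally show ?thesis using integral_unique[OF int] by simp
qed

section \<open>Reparametrisation and concatenation\<close>

lemma speed_affine_has_integral:
  assumes S: "finite S" and sm: "\<And>t. t \<in> {a..b} - S \<Longrightarrow> smooth_at A \<gamma> (m * t + k)"
    and eq: "\<And>t. a < t \<Longrightarrow> t < b \<Longrightarrow> \<gamma>' t = \<gamma> (m * t + k)" and m: "m \<noteq> 0" and ab: "a \<le> b"
    and I: "(speed \<gamma> has_integral I) ((\<lambda>t. m * t + k) ` {a..b})"
  shows "(speed \<gamma>' has_integral I) {a..b}"
proof -
  have uv: "(\<lambda>t. m * t + k) ` {a..b} = cbox (min (m * a + k) (m * b + k)) (max (m * a + k) (m * b + k))"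
    (is "_ = cbox ?u ?v")
    unfolding image_affinity_atLeastAtMost using ab by (auto simp: min_def max_def mult_le_cancel_left)
  have im: "(\<lambda>x. (1 / m) *\<^sub>R x + - ((1 / m) *\<^sub>R k)) ` cbox ?u ?v = {a..b}"
    unfolding uv[symmetric] image_image using m by (auto simp: field_simps)
  have "((\<lambda>t. speed \<gamma> (m *\<^sub>R t + k)) has_integral (1 / \<bar>m\<bar> ^ DIM(real)) *\<^sub>R I) {a..b}"
    using has_integral_affinity[OF I[unfolded uv] m, of k] unfolding im .
  \<comment> \<open>The substitution produces 1/|m|, and the chain rule multiplies the speed by |m|;
    the two factors cancel, also for reversed curves.\<close>
  from has_integral_mult_right[OF this, of "\<bar>m\<bar>"]
  have h: "((\<lambda>t. \<bar>m\<bar> * speed \<gamma> (m * t + k)) has_integral I) {a..b}"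
    using m by simp
  show ?thesis
  proof (rule has_integral_spike_finite[OF _ _ h])
    show "finite (insert a (insert b S))" using S by simp
    fix t assume t: "t \<in> {a..b} - insert a (insert b S)"
    have "\<forall>\<^sub>F x in nhds t. x \<in> {a<..<b}" using t by (intro eventually_nhds_in_open) auto
    then have ev: "\<forall>\<^sub>F x in nhds t. \<gamma>' x = \<gamma> (m * x + k)"
      by eventually_elim (use eq in auto)
    have sm': "smooth_at A \<gamma> (m * t + k)" using sm t by auto
    have eqt: "\<gamma>' t = \<gamma> (m * t + k)" using ev by (rule eventually_nhds_x_imp_x)
    define c where "c = chart_at A (\<gamma>' t)"
    have c: "c \<in> A" "\<gamma>' t \<in> fst c" using chart_at[OF surface] unfolding c_def by auto
    show "speed \<gamma>' t = \<bar>m\<bar> * speed \<gamma> (m * t + k)"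
      using speed_chart[OF smooth_at_affine(1)[OF sm' ev] c] speed_chart[OF sm' c(1)] c eqt
        smooth_at_affine(2)[OF sm' ev c]
      by (simp add: g_scaleR real_sqrt_mult del: complex_scaleR scaleR_conv_of_real)
  qed
qed

text \<open>The left-hand side is the integral of a nonnegative speed over a subinterval. With
  \<open>u = 1\<close> and \<open>v = 0\<close> this bounds the length of the reversed curve, which
  gives symmetry of the distance.\<close>

lemma curve_length_subpath:
  assumes \<gamma>: "piecewise_C1_curve A \<gamma>" and uv: "u \<in> {0..1}" "v \<in> {0..1}" "u \<noteq> v"
  shows "curve_length A g (\<lambda>t. \<gamma> ((v - u) * t + u)) \<le> curve_length A g \<gamma>"
proof -
  obtain S where S: "finite S" "\<And>t. t \<in> {0..1} - S \<Longrightarrow> smooth_at A \<gamma> t"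
    using piecewise_C1_smooth_at[OF \<gamma>] by blast
  let ?f = "\<lambda>t. (v - u) * t + u"
  have im: "?f ` {0..1} = {min u v..max u v}"
    unfolding image_affinity_atLeastAtMost using uv by auto
  have sub: "{min u v..max u v} \<subseteq> {0..1}" using uv by auto
  have i: "speed \<gamma> integrable_on {min u v..max u v}"
    by (rule integrable_on_subinterval[OF speed_integrable[OF \<gamma>] sub])
  have "(speed (\<lambda>t. \<gamma> ((v - u) * t + u)) has_integral integral {min u v..max u v} (speed \<gamma>)) {0..1}"
  proof (rule speed_affine_has_integral)
    show "finite (?f -` S)" by (rule finite_vimageI[OF S(1)]) (use uv in \<open>auto simp: inj_def\<close>)
    show "smooth_at A \<gamma> (?f t)" if "t \<in> {0..1} - ?f -` S" for t
    proof -
      have "?f t \<in> ?f ` {0..1}" using that by blast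
      then have "?f t \<in> {0..1}" unfolding im using sub by blast
      then show ?thesis using that S(2) by blast
    qed
  qed (use i im uv in \<open>auto\<close>)
  then have "curve_length A g (\<lambda>t. \<gamma> ((v - u) * t + u)) = integral {min u v..max u v} (speed \<gamma>)"
    unfolding curve_length_eq by (rule integral_unique)
  also have "\<dots> \<le> curve_length A g \<gamma>"
    unfolding curve_length_eq
    by (rule integral_subset_le[OF sub i speed_integrable[OF \<gamma>]]) (use speed_nonneg in auto)
  finally show ?thesis .
qed

lemma curve_length_join:
  assumes \<gamma>: "piecewise_C1_curve A \<gamma>1" "piecewise_C1_curve A \<gamma>2"
  shows "curve_length A g (\<gamma>1 +++ \<gamma>2) = curve_length A g \<gamma>1 + curve_length A g \<gamma>2"
proof -
  obtain S where S: "finite S" "\<And>t. t \<in> {0..1} - S \<Longrightarrow> smooth_at A \<gamma>1 t"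
    using piecewise_C1_smooth_at[OF \<gamma>(1)] by blast
  obtain S' where S': "finite S'" "\<And>t. t \<in> {0..1} - S' \<Longrightarrow> smooth_at A \<gamma>2 t"
    using piecewise_C1_smooth_at[OF \<gamma>(2)] by blast
  have "(speed (\<gamma>1 +++ \<gamma>2) has_integral curve_length A g \<gamma>1) {0..1/2}"
  proof (rule speed_affine_has_integral[where m = 2 and k = 0 and \<gamma> = \<gamma>1])
    show "finite ((*) 2 -` S)" by (rule finite_vimageI[OF S(1)]) (auto simp: inj_def)
    show "smooth_at A \<gamma>1 (2 * t + 0)" if "t \<in> {0..1/2} - (*) 2 -` S" for t
      using S(2)[of "2 * t"] that by auto
    show "(speed \<gamma>1 has_integral curve_length A g \<gamma>1) ((\<lambda>t. 2 * t + 0) ` {0..1 / 2})"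
      unfolding image_affinity_atLeastAtMost curve_length_eq
      using speed_integrable[OF \<gamma>(1)] by (simp add: integrable_integral)
  qed (auto simp: joinpaths_def)
  moreover have "(speed (\<gamma>1 +++ \<gamma>2) has_integral curve_length A g \<gamma>2) {1/2..1}"
  proof (rule speed_affine_has_integral[where m = 2 and k = "-1" and \<gamma> = \<gamma>2])
    show "finite ((\<lambda>t. 2 * t + -1) -` S')" by (rule finite_vimageI[OF S'(1)]) (auto simp: inj_def)
    show "smooth_at A \<gamma>2 (2 * t + -1)" if "t \<in> {1/2..1} - (\<lambda>t. 2 * t + -1) -` S'" for t
      using S'(2)[of "2 * t + -1"] that by auto
    show "(speed \<gamma>2 has_integral curve_length A g \<gamma>2) ((\<lambda>t. 2 * t + -1) ` {1/2..1})"
      unfolding image_affinity_atLeastAtMost curve_length_eq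
      using speed_integrable[OF \<gamma>(2)] by (simp add: integrable_integral)
  qed (auto simp: joinpaths_def)
  ultimately have "(speed (\<gamma>1 +++ \<gamma>2) has_integral
      curve_length A g \<gamma>1 + curve_length A g \<gamma>2) {0..1}"
    by (intro has_integral_combine[of 0 "1/2" 1]) auto
  then show ?thesis unfolding curve_length_eq[of "\<gamma>1 +++ \<gamma>2"] by (rule integral_unique)
qed

section \<open>Local comparison with the coordinate metric\<close>

abbreviation "dist_g \<equiv> riemannian_dist A g"

abbreviation curves :: "'a \<Rightarrow> 'a \<Rightarrow> (real \<Rightarrow> 'a) set" where
  "curves p q \<equiv> {\<gamma>. piecewise_C1_curve A \<gamma> \<and> \<gamma> 0 = p \<and> \<gamma> 1 = q}"

text \<open>The norm is continuous and positive on the compact product of a closed coordinate ball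
  with the unit circle, so it has a positive minimum and a maximum there; homogeneity extends both
  bounds to all vectors.\<close>

lemma locally_comparable:
  assumes c: "c \<in> A" and p: "p \<in> fst c"
  obtains r m M where "r > 0" "m > 0" "M > 0" "cball (snd c p) r \<subseteq> snd c ` fst c"
    "\<And>q v. q \<in> fst c \<Longrightarrow> snd c q \<in> cball (snd c p) r \<Longrightarrow> m * norm v \<le> sqrt (g c q v v)"
    "\<And>q v. q \<in> fst c \<Longrightarrow> snd c q \<in> cball (snd c p) r \<Longrightarrow> sqrt (g c q v v) \<le> M * norm v"
proof -
  note ch = chart[OF c]
  obtain r where r: "r > 0" "cball (snd c p) r \<subseteq> snd c ` fst c"
    using chart_open(2)[OF ch] p open_contains_cball by blast
  define K where "K = cball (snd c p) r \<times> sphere (0::complex) 1"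
  define f where "f x = sqrt (g c (chart_inv c (fst x)) (snd x) (snd x))" for x
  have K: "compact K" "K \<noteq> {}"
    using r by (auto simp: K_def intro!: compact_Times)
  have inv: "chart_inv c ` fst ` K \<subseteq> fst c"
    using r chart_inv_mem[OF ch] by (auto simp: K_def)
  have "continuous_on K (\<lambda>x. chart_inv c (fst x))"
    by (rule continuous_on_compose2[OF chart_inv_continuous[OF ch] continuous_on_fst[OF continuous_on_id]])
      (use r in \<open>auto simp: K_def\<close>)
  then have cont: "continuous_on K f"
    unfolding f_def using inv
    by (intro continuous_on_real_sqrt continuous_on_g[OF c] continuous_on_snd[OF continuous_on_id])
      (simp_all add: image_image)
  obtain x where x: "x \<in> K" "\<And>y. y \<in> K \<Longrightarrow> f x \<le> f y"
    using continuous_attains_inf[OF K cont] by blast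
  obtain y where y: "y \<in> K" "\<And>z. z \<in> K \<Longrightarrow> f z \<le> f y"
    using continuous_attains_sup[OF K cont] by blast
  have "snd x \<noteq> 0" using x(1) by (auto simp: K_def)
  moreover have "chart_inv c (fst x) \<in> fst c" using inv x(1) by blast
  ultimately have fx: "f x > 0" unfolding f_def using g_pos[OF c] by simp
  have key: "f x * norm v \<le> sqrt (g c q v v) \<and> sqrt (g c q v v) \<le> f y * norm v"
    if q: "q \<in> fst c" "snd c q \<in> cball (snd c p) r" for q v
  proof (cases "v = 0")
    case True
    then show ?thesis using g_scaleR[OF c q(1), of 0 v] by simp
  next
    case False
    define u where "u = v /\<^sub>R norm v"
    have v: "v = norm v *\<^sub>R u" using False by (simp add: u_def)
    have "(snd c q, u) \<in> K" using q False by (simp add: K_def u_def)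
    moreover have "f (snd c q, u) = sqrt (g c q u u)" using ch q by (simp add: f_def)
    moreover have "sqrt (g c q v v) = norm v * sqrt (g c q u u)"
      by (subst (1 2) v, subst g_scaleR[OF c q(1)]) (simp add: real_sqrt_mult)
    ultimately show ?thesis using x(2) y(2) by (metis mult.commute mult_left_mono norm_ge_zero)
  qed
  have "f y > 0" using fx x(2) y(1) by fastforce
  then show ?thesis using that[OF r(1) fx _ r(2)] key by blast
qed

text \<open>The preimage of a coordinate segment has speed at most \<open>M * norm (z - z0)\<close>.
  This yields upper bounds for distances, and curves from a point to all its neighbours.\<close>

lemma segment_curve:
  assumes c: "c \<in> A" and r: "cball z0 r \<subseteq> snd c ` fst c" and z: "z0 \<in> cball z0 r" "z \<in> cball z0 r"
    and M: "\<And>q v. q \<in> fst c \<Longrightarrow> snd c q \<in> cball z0 r \<Longrightarrow> sqrt (g c q v v) \<le> M * norm v"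
  obtains \<gamma> where "piecewise_C1_curve A \<gamma>" "\<gamma> 0 = chart_inv c z0" "\<gamma> 1 = chart_inv c z"
    "curve_length A g \<gamma> \<le> M * norm (z - z0)"
proof -
  note ch = chart[OF c]
  let ?l = "linepath z0 z"
  define \<gamma> where "\<gamma> = chart_inv c \<circ> ?l"
  have l: "?l t \<in> cball z0 r" if "t \<in> {0..1}" for t
    using that z linepath_in_convex_hull[of z0 "cball z0 r" z t] convex_cball[of z0 r]
    by (metis atLeastAtMost_iff convex_hull_eq)
  have lc: "\<gamma> t \<in> fst c" "snd c (\<gamma> t) = ?l t" if "t \<in> {0..1}" for t
    using l[OF that] r chart_inv_mem[OF ch, of "?l t"] chart_chart_inv[OF ch, of "?l t"]
    by (auto simp: \<gamma>_def)
  have path: "path \<gamma>"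
    unfolding path_def \<gamma>_def
    by (intro continuous_on_compose continuous_on_linepath
        continuous_on_subset[OF chart_inv_continuous[OF ch]]) (use l r in blast)
  have C1: "C1_curve_on A 0 1 \<gamma>"
    unfolding C1_curve_on_def
  proof
    \<comment> \<open>\<open>C1_curve_on\<close> asks for all charts of the atlas, so the straight
      segment is viewed through each transition map.\<close>
    fix c' assume c': "c' \<in> A"
    let ?T = "snd c' \<circ> chart_inv c" and ?X = "snd c ` (fst c \<inter> fst c')"
    note T = transition_holomorphic[OF surface c c']
    have lX: "?l t \<in> ?X" if "t \<in> {0..1}" "\<gamma> t \<in> fst c'" for t
      using lc[OF that(1)] that(2) by (metis IntI image_eqI)
    let ?D = "\<lambda>t. (z - z0) * deriv ?T (?l t)"
    have "continuous_on {t \<in> {0..1}. \<gamma> t \<in> fst c'} ?D"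
      by (intro continuous_intros continuous_on_compose2[OF holomorphic_on_imp_continuous_on[OF
              holomorphic_deriv[OF T]]] continuous_on_linepath) (use lX in auto)
    moreover have "((snd c' \<circ> \<gamma>) has_vector_derivative ?D t) (at t within {0..1})"
      if t: "t \<in> {0..1}" "\<gamma> t \<in> fst c'" for t
    proof -
      have "((?T \<circ> ?l) has_vector_derivative ?D t) (at t within {0..1})"
        by (rule field_vector_diff_chain_within[OF has_vector_derivative_linepath_within])
          (rule has_field_derivative_at_within[OF holomorphic_derivI[OF T lX[OF t]]])
      then show ?thesis by (simp add: \<gamma>_def comp_assoc)
    qed
    ultimately show "\<exists>D. continuous_on {t \<in> {0..1}. \<gamma> t \<in> fst c'} D \<and>
      (\<forall>t\<in>{0..1}. \<gamma> t \<in> fst c' \<longrightarrow> ((snd c' \<circ> \<gamma>) has_vector_derivative D t) (at t within {0..1}))"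
      by blast
  qed
  have pc: "piecewise_C1_curve A \<gamma>"
    unfolding piecewise_C1_curve_def
  proof (intro conjI path exI[of _ "{}"] allI impI)
    fix a b :: real assume "0 \<le> a \<and> a < b \<and> b \<le> 1 \<and> {a<..<b} \<inter> {} = {}"
    then show "C1_curve_on A a b \<gamma>" by (intro C1_curve_on_affine[OF C1, of a b 1 0]) auto
  qed simp
  obtain S where S: "finite S" "\<And>t. t \<in> {0..1} - S \<Longrightarrow> smooth_at A \<gamma> t"
    using piecewise_C1_smooth_at[OF pc] by blast
  have sp: "speed \<gamma> t \<le> M * norm (z - z0)" if t: "t \<in> {0..1} - insert 0 (insert 1 S)" for t
  proof -
    have t01: "t \<in> {0..1}" and sm: "smooth_at A \<gamma> t" using t S by auto
    have "((snd c \<circ> \<gamma>) has_vector_derivative velocity c \<gamma> t) (at t)"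
      using sm c lc[OF t01] unfolding smooth_at_def by blast
    then have "((snd c \<circ> \<gamma>) has_vector_derivative velocity c \<gamma> t) (at t within {0..1})"
      by (rule has_vector_derivative_at_within)
    then have "(?l has_vector_derivative velocity c \<gamma> t) (at t within {0..1})"
      by (rule has_vector_derivative_transform[OF t01, rotated]) (use lc in auto)
    then have "velocity c \<gamma> t = z - z0"
      using has_vector_derivative_linepath_within vector_derivative_unique_within_closed_interval[of 0 1] t01
      by (metis box_real(2) zero_less_one)
    then show ?thesis
      using M[OF lc(1)[OF t01]] lc(2)[OF t01] l[OF t01] speed_chart[OF sm c lc(1)[OF t01]] by auto
  qed
  \<comment> \<open>\<open>M\<close> is not assumed nonnegative; the sign follows from the bound
    \<open>M\<close> at the starting point and is required by the integral estimate.\<close>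
  have "M * norm (z - z0) \<ge> 0" using M[of "\<gamma> 0" "z - z0"] lc[of 0] z(1) g_nonneg[OF c, of "\<gamma> 0" "z - z0"]
    by (smt (verit) atLeastAtMost_iff linepath_0' real_sqrt_ge_zero)
  moreover have "(speed \<gamma> has_integral curve_length A g \<gamma>) (cbox 0 1)"
    using speed_integrable[OF pc] by (simp add: curve_length_eq integrable_integral)
  ultimately have "\<bar>curve_length A g \<gamma>\<bar> \<le> M * norm (z - z0)"
    using has_integral_bound_spike_finite[of "M * norm (z - z0)" "insert 0 (insert 1 S)" "speed \<gamma>" _ 0 1]
      sp speed_nonneg S(1) by auto
  then have "curve_length A g \<gamma> \<le> M * norm (z - z0)" by (rule abs_le_D1)
  then show ?thesis
    using that[OF pc] by (simp add: \<gamma>_def linepath_0' linepath_1')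
qed

text \<open>Being joined by a piecewise C1 curve is an equivalence relation with open classes
  (coordinate segments), so connectedness leaves only one class. This makes the infimum in the
  distance meaningful.\<close>

lemma curves_nonempty: "curves p q \<noteq> {}"
proof -
  define R where "R p q \<longleftrightarrow> curves p q \<noteq> {}" for p q
  have "connected (UNIV :: 'a set)" using surface unfolding riemann_surface_def by blast
  then have "R p q"
  proof (rule connected_equivalence_relation)
    fix p q assume "R p q"
    then obtain \<gamma> where \<gamma>: "piecewise_C1_curve A \<gamma>" "\<gamma> 0 = p" "\<gamma> 1 = q" unfolding R_def by blast
    have "piecewise_C1_curve A (\<lambda>t. \<gamma> ((0 - 1) * t + 1))"
      by (rule piecewise_C1_subpath[OF \<gamma>(1)]) auto
    then have "(\<lambda>t. \<gamma> ((0 - 1) * t + 1)) \<in> curves q p" using \<gamma> by simp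
    then show "R q p" unfolding R_def by blast
  next
    fix p q r assume "R p q" "R q r"
    then obtain \<gamma>1 \<gamma>2 where "piecewise_C1_curve A \<gamma>1" "\<gamma>1 0 = p" "\<gamma>1 1 = q"
      "piecewise_C1_curve A \<gamma>2" "\<gamma>2 0 = q" "\<gamma>2 1 = r" unfolding R_def by blast
    then have "\<gamma>1 +++ \<gamma>2 \<in> curves p r"
      using piecewise_C1_join[of A \<gamma>1 \<gamma>2] by (simp add: joinpaths_def)
    then show "R p r" unfolding R_def by blast
  next
    fix p :: 'a
    obtain c where c: "c \<in> A" "p \<in> fst c" using chart_at[OF surface] by blast
    note ch = chart[OF c(1)]
    obtain r m M where r: "r > 0" "cball (snd c p) r \<subseteq> snd c ` fst c"
      "\<And>q v. q \<in> fst c \<Longrightarrow> snd c q \<in> cball (snd c p) r \<Longrightarrow> sqrt (g c q v v) \<le> M * norm v"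
      using locally_comparable[OF c] by metis
    have "open (chart_inv c ` ball (snd c p) r)"
      by (rule open_chart_inv_image[OF ch]) (use r in auto)
    moreover have "p \<in> chart_inv c ` ball (snd c p) r"
      using r ch c by (auto intro!: image_eqI[of _ _ "snd c p"])
    moreover have "R p q" if q: "q \<in> chart_inv c ` ball (snd c p) r" for q
    proof -
      obtain z where "z \<in> ball (snd c p) r" and zq: "q = chart_inv c z" using q by blast
      then have z: "z \<in> cball (snd c p) r" by simp
      obtain \<gamma> where "piecewise_C1_curve A \<gamma>" "\<gamma> 0 = chart_inv c (snd c p)" "\<gamma> 1 = chart_inv c z"
        using segment_curve[OF c(1) r(2) _ z(1) r(3)] r(1) by auto
      then show ?thesis unfolding R_def using zq ch c by auto
    qed
    ultimately show "\<exists>T. openin (top_of_set UNIV) T \<and> p \<in> T \<and> (\<forall>x\<in>T. R p x)"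
      by (auto simp: open_openin[symmetric])
  qed auto
  then show ?thesis unfolding R_def .
qed

section \<open>The distance as an infimum of lengths\<close>

lemma dist_g_le: "piecewise_C1_curve A \<gamma> \<Longrightarrow> dist_g (\<gamma> 0) (\<gamma> 1) \<le> curve_length A g \<gamma>"
  unfolding riemannian_dist_def
  by (rule cINF_lower) (auto intro!: bdd_belowI2[where m = 0] curve_length_nonneg)

lemma dist_g_less:
  assumes "dist_g p q < e"
  obtains \<gamma> where "piecewise_C1_curve A \<gamma>" "\<gamma> 0 = p" "\<gamma> 1 = q" "curve_length A g \<gamma> < e"
proof -
  have "bdd_below (curve_length A g ` curves p q)"
    by (auto intro!: bdd_belowI2[where m = 0] curve_length_nonneg)
  then obtain \<gamma> where "\<gamma> \<in> curves p q" "curve_length A g \<gamma> < e"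
    using assms cINF_less_iff[OF curves_nonempty[of p q]] unfolding riemannian_dist_def by blast
  then show ?thesis using that by blast
qed

lemma dist_g_nonneg: "0 \<le> dist_g p q"
  unfolding riemannian_dist_def
  by (rule cINF_greatest[OF curves_nonempty]) (auto intro: curve_length_nonneg)

text \<open>The curve is the degenerate coordinate segment from the point to itself, whose length
  bound is 0.\<close>

lemma dist_g_refl: "dist_g p p = 0"
proof -
  obtain c where c: "c \<in> A" "p \<in> fst c" using chart_at[OF surface] by blast
  obtain r m M where r: "r > 0" "cball (snd c p) r \<subseteq> snd c ` fst c"
    "\<And>q v. q \<in> fst c \<Longrightarrow> snd c q \<in> cball (snd c p) r \<Longrightarrow> sqrt (g c q v v) \<le> M * norm v"
    using locally_comparable[OF c] by metis
  obtain \<delta> where "piecewise_C1_curve A \<delta>" "\<delta> 0 = p" "\<delta> 1 = p" "curve_length A g \<delta> \<le> 0"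
    using segment_curve[OF c(1) r(2) _ _ r(3), of "snd c p"] r(1) chart[OF c(1)] c(2) by auto
  then show ?thesis using dist_g_le[of \<delta>] dist_g_nonneg[of p p] by auto
qed

text \<open>This confines a short curve to a small ball around its start, and so keeps it off a
  compact set from which the start is far away.\<close>

lemma dist_g_initial_le:
  assumes "piecewise_C1_curve A \<gamma>" "t \<in> {0..1}"
  shows "dist_g (\<gamma> 0) (\<gamma> t) \<le> curve_length A g \<gamma>"
proof (cases "t = 0")
  case False
  then show ?thesis
    using dist_g_le[OF piecewise_C1_subpath[OF assms(1), of 0 t]]
      curve_length_subpath[OF assms(1), of 0 t] assms(2) by simp
next
  case True
  then show ?thesis using dist_g_refl curve_length_nonneg[OF assms(1)] by simp
qed

text \<open>Every unit of coordinate distance costs at least \<open>m\<close> in length, so a curve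
  shorter than \<open>m * r\<close> cannot afford to leave the coordinate ball. Since
  \<open>lower\<close> holds only inside that ball, the estimate has to be combined with a
  continuity argument. Positivity of the distance and one half of the topology comparison rest on
  this.\<close>

lemma short_curve_in_chart:
  assumes c: "c \<in> A" and p: "p \<in> fst c" and r: "cball (snd c p) r \<subseteq> snd c ` fst c" and m: "m > 0"
    and lower: "\<And>q v. q \<in> fst c \<Longrightarrow> snd c q \<in> cball (snd c p) r \<Longrightarrow> m * norm v \<le> sqrt (g c q v v)"
    and \<gamma>: "piecewise_C1_curve A \<gamma>" "\<gamma> 0 = p" and L: "curve_length A g \<gamma> < m * r"
  shows "\<gamma> 1 \<in> fst c" "m * norm (snd c (\<gamma> 1) - snd c p) \<le> curve_length A g \<gamma>"
proof -
  note ch = chart[OF c]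
  \<comment> \<open>This is the coordinate distance that the length can pay for. As it is strictly
    below \<open>r\<close>, the closed ball \<open>K\<close> of radius \<rho> lies in the open ball
    \<open>V\<close>.\<close>
  define \<rho> where "\<rho> = curve_length A g \<gamma> / m"
  have \<rho>: "0 \<le> \<rho>" "\<rho> < r" using curve_length_nonneg[OF \<gamma>(1)] L m by (auto simp: \<rho>_def field_simps)
  define V where "V = chart_inv c ` ball (snd c p) r"
  define K where "K = chart_inv c ` cball (snd c p) \<rho>"
  have V: "open V" "V \<subseteq> fst c" "\<And>q. q \<in> V \<Longrightarrow> snd c q \<in> cball (snd c p) r"
  proof -
    have sub: "ball (snd c p) r \<subseteq> snd c ` fst c" using r by auto
    show "open V" unfolding V_def by (rule open_chart_inv_image[OF ch _ sub]) simp
    show "V \<subseteq> fst c" "\<And>q. q \<in> V \<Longrightarrow> snd c q \<in> cball (snd c p) r"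
      using sub chart_inv_mem[OF ch] chart_chart_inv[OF ch] by (auto simp: V_def subset_eq)
  qed
  \<comment> \<open>Compactness makes \<open>K\<close> closed in the whole Hausdorff surface and not
    merely inside the chart.\<close>
  have "compact K"
    unfolding K_def
    by (rule compact_continuous_image[OF continuous_on_subset[OF chart_inv_continuous[OF ch]]])
      (use r \<rho> in auto)
  then have K: "closed K" "K \<subseteq> V"
    using \<rho> by (auto simp: K_def V_def compact_imp_closed)
  have cont: "continuous_on {0..1} \<gamma>" using \<gamma>(1) by (simp add: piecewise_C1_curve_def path_def)
  have bound: "norm (snd c (\<gamma> s) - snd c p) \<le> \<rho>" if s: "s \<in> {0..1}" "\<gamma> ` {0..s} \<subseteq> V" for s
  proof -
    have "norm (snd c (\<gamma> s) - snd c (\<gamma> 0)) \<le> (1 / m) * curve_length A g \<gamma>"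
    proof (rule increment_le_curve_length[OF \<gamma>(1)])
      show "continuous_on {0..s} (snd c \<circ> \<gamma>)"
        by (intro continuous_on_compose continuous_on_subset[OF cont]
            continuous_on_subset[OF chart_continuous[OF ch]]) (use s V in auto)
      fix t assume t: "0 < t" "t < s" and sm: "smooth_at A \<gamma> t"
      have tV: "\<gamma> t \<in> V" using s t by auto
      then have tc: "\<gamma> t \<in> fst c" using V by auto
      have "norm (velocity c \<gamma> t) \<le> 1 / m * speed \<gamma> t"
        using lower[OF tc V(3)[OF tV]] speed_chart[OF sm c tc] m by (simp add: field_simps)
      then show "\<exists>D. ((snd c \<circ> \<gamma>) has_vector_derivative D) (at t) \<and> norm D \<le> 1 / m * speed \<gamma> t"
        using sm c tc unfolding smooth_at_def by blast
    qed (use s m in auto)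
    then show ?thesis using \<gamma>(2) by (simp add: \<rho>_def)
  qed
  have inK: "q \<in> K" if "q \<in> V" "norm (snd c q - snd c p) \<le> \<rho>" for q
    using that V(2) ch unfolding K_def
    by (intro image_eqI[of _ _ "snd c q"]) (auto simp: dist_norm norm_minus_commute)
  define E where "E = {0..1} \<inter> \<gamma> -` (- V)"
  have E: "closed E" unfolding E_def by (rule continuous_closed_preimage[OF cont]) (use V in auto)
  \<comment> \<open>At the first exit time \<open>s\<close> from \<open>V\<close> the curve is still in the compact set \<open>K \<subseteq> V\<close>.\<close>
  have "E = {}"
  proof (rule ccontr)
    assume ne: "E \<noteq> {}"
    have bdd: "bdd_below E" by (auto simp: E_def intro: bdd_belowI[of _ 0])
    define s where "s = Inf E"
    have s: "s \<in> E" unfolding s_def by (rule closed_contains_Inf[OF ne bdd E])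
    have lt: "\<gamma> t \<in> V" if "t \<in> {0..<s}" for t
      using that s cInf_lower[OF _ bdd, of t] unfolding s_def[symmetric] by (force simp: E_def)
    have "\<gamma> 0 \<in> V" unfolding \<gamma>(2) V_def
      using \<rho> p ch by (intro image_eqI[of _ _ "snd c p"]) auto
    then have s0: "0 < s" using s by (auto simp: E_def order_le_less)
    have "\<gamma> t \<in> K" if t: "t \<in> {0..<s}" for t
    proof (rule inK[OF lt[OF t] bound])
      show "t \<in> {0..1}" using t s by (auto simp: E_def)
      show "\<gamma> ` {0..t} \<subseteq> V" using lt t by auto
    qed
    then have sub: "{0..<s} \<subseteq> {0..1} \<inter> \<gamma> -` K" using s by (auto simp: E_def)
    have "closed ({0..1} \<inter> \<gamma> -` K)" by (rule continuous_closed_preimage[OF cont _ K(1)]) simp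
    from closure_minimal[OF sub this] have "{0..s} \<subseteq> {0..1} \<inter> \<gamma> -` K" using s0 by simp
    then have "\<gamma> s \<in> K" using s0 by (simp add: subset_eq)
    then show False using s K by (auto simp: E_def)
  qed
  then have "\<gamma> ` {0..1} \<subseteq> V" by (auto simp: E_def)
  then show "\<gamma> 1 \<in> fst c" "m * norm (snd c (\<gamma> 1) - snd c p) \<le> curve_length A g \<gamma>"
    using bound[of 1] V(2) m image_subset_iff[of \<gamma> "{0..1}" V] by (auto simp: \<rho>_def field_simps)
qed

lemma dist_g_pos:
  assumes "p \<noteq> q" shows "dist_g p q > 0"
proof -
  obtain c where c: "c \<in> A" "p \<in> fst c" using chart_at[OF surface] by blast
  obtain r m M where r: "r > 0" "m > 0" "cball (snd c p) r \<subseteq> snd c ` fst c"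
    "\<And>q v. q \<in> fst c \<Longrightarrow> snd c q \<in> cball (snd c p) r \<Longrightarrow> m * norm v \<le> sqrt (g c q v v)"
    using locally_comparable[OF c] by metis
  \<comment> \<open>If \<open>q\<close> is outside the chart, a curve to it must be too long to stay
    in the ball of radius \<open>r\<close>; if \<open>q\<close> is inside, the coordinate distance
    from \<open>p\<close> is also an obstruction.\<close>
  define e where "e = (if q \<in> fst c then min r (norm (snd c q - snd c p)) else r)"
  have inj: "snd c q \<noteq> snd c p" if "q \<in> fst c"
    using chart_inv_chart[OF chart[OF c(1)]] that c(2) assms by metis
  have "e > 0" using r inj by (auto simp: e_def)
  have "\<not> dist_g p q < m * e"
  proof
    assume "dist_g p q < m * e"
    then obtain \<gamma> where \<gamma>: "piecewise_C1_curve A \<gamma>" "\<gamma> 0 = p" "\<gamma> 1 = q" "curve_length A g \<gamma> < m * e"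
      using dist_g_less by blast
    have "m * e \<le> m * r" using r by (simp add: e_def)
    with \<gamma> have "curve_length A g \<gamma> < m * r" by simp
    note s = short_curve_in_chart[OF c r(3,2,4) \<gamma>(1,2) this]
    then have "m * norm (snd c q - snd c p) < m * e" "q \<in> fst c" using \<gamma> by auto
    then show False using r by (simp add: e_def)
  qed
  then show ?thesis using r \<open>e > 0\<close> by (smt (verit) mult_pos_pos)
qed

lemma Metric_space_dist_g: "Metric_space UNIV dist_g"
proof
  fix p q r :: 'a
  show "0 \<le> dist_g p q" by (rule dist_g_nonneg)
  have le: "dist_g p q \<le> dist_g q p" for p q
  proof (rule field_le_epsilon)
    fix e :: real assume "e > 0"
    then obtain \<gamma> where \<gamma>: "piecewise_C1_curve A \<gamma>" "\<gamma> 0 = q" "\<gamma> 1 = p"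
      "curve_length A g \<gamma> < dist_g q p + e"
      using dist_g_less[of q p "dist_g q p + e"] by auto
    then show "dist_g p q \<le> dist_g q p + e"
      using dist_g_le[OF piecewise_C1_subpath[OF \<gamma>(1), of 1 0]]
        curve_length_subpath[OF \<gamma>(1), of 1 0] by simp
  qed
  show "dist_g p q = dist_g q p" by (rule antisym[OF le le])
  show "dist_g p q = 0 \<longleftrightarrow> p = q"
  proof
    assume "p = q"
    then show "dist_g p q = 0" using dist_g_refl by simp
  qed (use dist_g_pos in fastforce)
  show "dist_g p r \<le> dist_g p q + dist_g q r"
  proof (rule field_le_epsilon)
    fix e :: real assume e: "e > 0"
    obtain \<gamma>1 where 1: "piecewise_C1_curve A \<gamma>1" "\<gamma>1 0 = p" "\<gamma>1 1 = q"
      "curve_length A g \<gamma>1 < dist_g p q + e/2"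
      using dist_g_less[of p q "dist_g p q + e/2"] e by auto
    obtain \<gamma>2 where 2: "piecewise_C1_curve A \<gamma>2" "\<gamma>2 0 = q" "\<gamma>2 1 = r"
      "curve_length A g \<gamma>2 < dist_g q r + e/2"
      using dist_g_less[of q r "dist_g q r + e/2"] e by auto
    have "\<gamma>1 1 = \<gamma>2 0" using 1 2 by simp
    from dist_g_le[OF piecewise_C1_join[OF 1(1) 2(1) this]]
    have "dist_g p r \<le> curve_length A g \<gamma>1 + curve_length A g \<gamma>2"
      using 1 2 curve_length_join[OF 1(1) 2(1)] by (simp add: joinpaths_def)
    then show "dist_g p r \<le> dist_g p q + dist_g q r + e" using 1 2 by simp
  qed
qed

text \<open>The lower comparison shows that points at small distance are near in coordinates, so
  open sets contain distance balls. The upper comparison, through coordinate segments, shows that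
  distance balls contain chart neighbourhoods. Compactness and limits thus become independent of the
  metric.\<close>

lemma openin_mtopology_dist_g: "openin (Metric_space.mtopology UNIV dist_g) U \<longleftrightarrow> open U"
proof -
  interpret M: Metric_space UNIV dist_g by (rule Metric_space_dist_g)
  have "\<exists>e>0. M.mball p e \<subseteq> U" if U: "open U" "p \<in> U" for p
  proof -
    obtain c where c: "c \<in> A" "p \<in> fst c" using chart_at[OF surface] by blast
    note ch = chart[OF c(1)]
    obtain r m M where r: "r > 0" "m > 0" "cball (snd c p) r \<subseteq> snd c ` fst c"
      "\<And>q v. q \<in> fst c \<Longrightarrow> snd c q \<in> cball (snd c p) r \<Longrightarrow> m * norm v \<le> sqrt (g c q v v)"
      using locally_comparable[OF c] by metis
    have "open (snd c ` (U \<inter> fst c))"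
      using open_chart_image[OF ch] U chart_open[OF ch] by blast
    moreover have "snd c p \<in> snd c ` (U \<inter> fst c)" using U c by blast
    ultimately obtain \<rho> where \<rho>: "\<rho> > 0" "ball (snd c p) \<rho> \<subseteq> snd c ` (U \<inter> fst c)"
      unfolding open_contains_ball by blast
    define e where "e = min r \<rho>"
    have "q \<in> U" if q: "dist_g p q < m * e" for q
    proof -
      obtain \<gamma> where \<gamma>: "piecewise_C1_curve A \<gamma>" "\<gamma> 0 = p" "\<gamma> 1 = q" "curve_length A g \<gamma> < m * e"
        using dist_g_less[OF q] by blast
      have "m * e \<le> m * r" using r by (simp add: e_def)
      with \<gamma> have "curve_length A g \<gamma> < m * r" by simp
      note s = short_curve_in_chart[OF c r(3,2,4) \<gamma>(1,2) this]
      then have "m * norm (snd c q - snd c p) < m * e" and qc: "q \<in> fst c" using \<gamma> by auto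
      then have "snd c q \<in> ball (snd c p) \<rho>"
        using r by (simp add: e_def dist_norm norm_minus_commute)
      then obtain q' where "q' \<in> U" "q' \<in> fst c" "snd c q = snd c q'" using \<rho> by blast
      then show ?thesis using chart_inv_chart[OF ch] qc by metis
    qed
    then show ?thesis using r \<rho> by (intro exI[of _ "m * e"]) (auto simp: e_def M.mball_def)
  qed
  moreover have "open U" if U: "\<And>p. p \<in> U \<Longrightarrow> \<exists>e>0. M.mball p e \<subseteq> U"
  proof (subst open_subopen, rule ballI)
    fix p assume "p \<in> U"
    then obtain e where e: "e > 0" "M.mball p e \<subseteq> U" using U by blast
    obtain c where c: "c \<in> A" "p \<in> fst c" using chart_at[OF surface] by blast
    note ch = chart[OF c(1)]
    obtain r m M where r: "r > 0" "M > 0" "cball (snd c p) r \<subseteq> snd c ` fst c"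
      "\<And>q v. q \<in> fst c \<Longrightarrow> snd c q \<in> cball (snd c p) r \<Longrightarrow> sqrt (g c q v v) \<le> M * norm v"
      using locally_comparable[OF c] by metis
    define \<rho> where "\<rho> = min r (e / M)"
    have \<rho>: "\<rho> > 0" "\<rho> \<le> r" "M * \<rho> \<le> e" using r e by (auto simp: \<rho>_def min_def field_simps)
    let ?V = "chart_inv c ` ball (snd c p) \<rho>"
    have sub: "ball (snd c p) \<rho> \<subseteq> cball (snd c p) r" using \<rho> by auto
    have "open ?V" by (rule open_chart_inv_image[OF ch]) (use r sub in auto)
    moreover have "p \<in> ?V" using \<rho> c ch by (auto intro!: image_eqI[of _ _ "snd c p"])
    moreover have "?V \<subseteq> U"
    proof
      fix q assume "q \<in> ?V"
      then obtain z where z: "z \<in> ball (snd c p) \<rho>" "q = chart_inv c z" by blast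
      have zr: "z \<in> cball (snd c p) r" using z sub by blast
      obtain \<gamma> where \<gamma>: "piecewise_C1_curve A \<gamma>" "\<gamma> 0 = chart_inv c (snd c p)" "\<gamma> 1 = chart_inv c z"
        "curve_length A g \<gamma> \<le> M * norm (z - snd c p)"
        using segment_curve[OF c(1) r(3) _ zr r(4)] r(1) by auto
      have "M * norm (z - snd c p) < M * \<rho>"
        using z r by (simp add: dist_norm norm_minus_commute)
      then have "dist_g p q < e"
        using dist_g_le[OF \<gamma>(1)] \<gamma> z c ch \<rho> by simp
      then show "q \<in> U" using e by (auto simp: M.mball_def)
    qed
    ultimately show "\<exists>T. open T \<and> p \<in> T \<and> T \<subseteq> U" by blast
  qed
  ultimately show ?thesis unfolding M.openin_mtopology by auto
qed

lemma mtopology_dist_g: "Metric_space.mtopology UNIV dist_g = euclidean"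
  unfolding topology_eq openin_mtopology_dist_g by simp

end

section \<open>Comparison of complete metrics\<close>

text \<open>The tensors are quadratic, so a factor \<open>C\<close> becomes \<open>sqrt C\<close>
  for lengths. The hypothesis concerns only points of \<gamma>, because the comparison available
  later holds only along particular curves.\<close>

lemma curve_length_le_scaled:
  assumes s: "riemannian_surface A s" and g: "riemannian_surface A g"
    and \<gamma>: "piecewise_C1_curve A \<gamma>" and C: "C \<ge> 0"
    and le: "\<And>c t v. t \<in> {0..1} \<Longrightarrow> c \<in> A \<Longrightarrow> \<gamma> t \<in> fst c \<Longrightarrow> g c (\<gamma> t) v v \<le> C * s c (\<gamma> t) v v"
  shows "curve_length A g \<gamma> \<le> sqrt C * curve_length A s \<gamma>"
proof -
  interpret s: riemannian_surface A s by fact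
  interpret g: riemannian_surface A g by fact
  obtain S where S: "finite S" "\<And>t. t \<in> {0..1} - S \<Longrightarrow> smooth_at A \<gamma> t"
    using piecewise_C1_smooth_at[OF \<gamma>] by blast
  have le': "g.speed \<gamma> t \<le> sqrt C * s.speed \<gamma> t" if t: "t \<in> {0..1} - S" for t
  proof -
    note c = chart_at[OF s.surface, of "\<gamma> t"]
    show ?thesis
      using le[OF _ c] t s.speed_chart[OF S(2)[OF t] c] g.speed_chart[OF S(2)[OF t] c]
      by (simp add: real_sqrt_mult[symmetric])
  qed
  \<comment> \<open>The pointwise comparison is known only at smooth times. Setting the integrand to
    0 on the finite set \<open>S\<close> keeps the integral and gives an inequality
    everywhere.\<close>
  define f where "f t = (if t \<in> S then 0 else g.speed \<gamma> t)" for t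
  have f: "f integrable_on {0..1}"
    by (rule integrable_spike_finite[OF S(1) _ g.speed_integrable[OF \<gamma>]]) (simp add: f_def)
  have si: "(\<lambda>t. sqrt C * s.speed \<gamma> t) integrable_on {0..1}"
    using integrable_cmul[OF s.speed_integrable[OF \<gamma>], of "sqrt C"] by simp
  have "curve_length A g \<gamma> = integral {0..1} f"
    unfolding g.curve_length_eq
    by (rule integral_spike[OF negligible_finite[OF S(1)]]) (simp add: f_def)
  also have "\<dots> \<le> integral {0..1} (\<lambda>t. sqrt C * s.speed \<gamma> t)"
    by (rule integral_le[OF f si]) (use le' C s.speed_nonneg in \<open>auto simp: f_def\<close>)
  also have "\<dots> = sqrt C * curve_length A s \<gamma>" by (simp add: s.curve_length_eq)
  finally show ?thesis .
qed

text \<open>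
  A Cauchy sequence of \<open>s\<close> that keeps coming near \<open>K\<close> converges by compactness.  Otherwise
  short curves between its late members avoid \<open>K\<close>, and \<open>F\<close> is bounded along them because it is
  1-Lipschitz; so the sequence is also Cauchy for \<open>g\<close>, and both metrics induce the same topology.
\<close>

lemma complete_comparison:
  fixes F :: "'a::t2_space \<Rightarrow> 'e::euclidean_space"
  assumes s: "riemannian_surface A s" and g: "riemannian_surface A g"
    and complete: "Metric_space.mcomplete UNIV (riemannian_dist A g)"
    and F: "\<And>c p. c \<in> A \<Longrightarrow> p \<in> fst c \<Longrightarrow> ((F \<circ> chart_inv c) has_derivative L c p) (at (snd c p))"
    and L: "\<And>c p v. c \<in> A \<Longrightarrow> p \<in> fst c \<Longrightarrow> norm (L c p v) \<le> sqrt (s c p v v)"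
    and K: "compact K"
    and le: "\<And>c p v. c \<in> A \<Longrightarrow> p \<in> fst c \<Longrightarrow> p \<notin> K \<Longrightarrow> g c p v v \<le> norm (F p) * s c p v v"
  shows "Metric_space.mcomplete UNIV (riemannian_dist A s)"
proof -
  interpret s: riemannian_surface A s by fact
  interpret g: riemannian_surface A g by fact
  interpret S: Metric_space UNIV s.dist_g by (rule s.Metric_space_dist_g)
  interpret G: Metric_space UNIV g.dist_g by (rule g.Metric_space_dist_g)
  have derivF: "((F \<circ> \<gamma>) has_derivative (\<lambda>h. L c (\<gamma> t) (h *\<^sub>R velocity c \<gamma> t))) (at t)"
    if "smooth_at A \<gamma> t" and c: "c \<in> A" "\<gamma> t \<in> fst c" for \<gamma> c t
  proof -
    note ch = s.chart[OF c(1)]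
    have "((snd c \<circ> \<gamma>) has_derivative (\<lambda>h. h *\<^sub>R velocity c \<gamma> t)) (at t)"
      using that unfolding smooth_at_def has_vector_derivative_def by blast
    from diff_chain_at[OF this, of "F \<circ> chart_inv c"] F[OF c]
    have D: "((F \<circ> chart_inv c \<circ> (snd c \<circ> \<gamma>)) has_derivative
        (\<lambda>h. L c (\<gamma> t) (h *\<^sub>R velocity c \<gamma> t))) (at t)"
      by (simp add: o_def)
    have "\<forall>\<^sub>F x in nhds t. \<gamma> x \<in> fst c"
      using that topological_tendstoD[OF _ chart_open(1)[OF ch] c(2)]
      unfolding smooth_at_def isCont_def tendsto_at_iff_tendsto_nhds by blast
    then obtain U where U: "open U" "t \<in> U" "\<And>x. x \<in> U \<Longrightarrow> \<gamma> x \<in> fst c"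
      unfolding eventually_nhds by blast
    show ?thesis
      by (rule has_derivative_transform_within_open[OF D U(1,2)]) (use U ch in simp)
  qed
  have contF: "continuous_on UNIV F"
  proof (intro continuous_at_imp_continuous_on ballI)
    fix p
    obtain c where c: "c \<in> A" "p \<in> fst c" using chart_at[OF s.surface] by blast
    note ch = s.chart[OF c(1)]
    have 1: "isCont (snd c) p"
      using chart_continuous[OF ch] chart_open(1)[OF ch] c(2) continuous_on_eq_continuous_at by blast
    have 2: "isCont (F \<circ> chart_inv c) (snd c p)"
      using F[OF c] by (rule has_derivative_continuous)
    have "isCont (\<lambda>q. (F \<circ> chart_inv c) (snd c q)) p" by (rule isCont_o2[OF 1 2])
    moreover have "\<forall>\<^sub>F q in nhds p. (F \<circ> chart_inv c) (snd c q) = F q"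
      using eventually_nhds_in_open[OF chart_open(1)[OF ch] c(2)]
      by eventually_elim (simp add: ch)
    ultimately show "isCont F p" using isCont_cong[of "\<lambda>q. (F \<circ> chart_inv c) (snd c q)" F p] by blast
  qed
  \<comment> \<open>The bound is stated for all intermediate times because \<open>F\<close> must be
    controlled along the whole curve, not only at its end.\<close>
  have lipschitz: "norm (F (\<gamma> t) - F (\<gamma> 0)) \<le> curve_length A s \<gamma>"
    if \<gamma>: "piecewise_C1_curve A \<gamma>" and t: "t \<in> {0..1}" for \<gamma> t
  proof -
    have "norm (F (\<gamma> t) - F (\<gamma> 0)) \<le> 1 * curve_length A s \<gamma>"
    proof (rule s.increment_le_curve_length[OF \<gamma>])
      have "continuous_on {0..1} \<gamma>" using \<gamma> by (simp add: piecewise_C1_curve_def path_def)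
      then have "continuous_on {0..t} \<gamma>" by (rule continuous_on_subset) (use t in auto)
      then show "continuous_on {0..t} (F \<circ> \<gamma>)"
        by (rule continuous_on_compose) (rule continuous_on_subset[OF contF], simp)
      fix x assume sm: "smooth_at A \<gamma> x"
      note c = chart_at[OF s.surface, of "\<gamma> x"]
      let ?c = "chart_at A (\<gamma> x)"
      let ?D = "L ?c (\<gamma> x) (velocity ?c \<gamma> x)"
      have "linear (L ?c (\<gamma> x))" using F[OF c] by (rule has_derivative_linear)
      then have "((F \<circ> \<gamma>) has_vector_derivative ?D) (at x)"
        using derivF[OF sm c] unfolding has_vector_derivative_def by (simp add: linear_cmul)
      moreover have "norm ?D \<le> 1 * s.speed \<gamma> x"
        using L[OF c] s.speed_chart[OF sm c] by simp
      ultimately show "\<exists>D. ((F \<circ> \<gamma>) has_vector_derivative D) (at x) \<and> norm D \<le> 1 * s.speed \<gamma> x"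
        by blast
    qed (use t in auto)
    then show ?thesis by simp
  qed
  show ?thesis
    unfolding S.mcomplete_def
  proof (intro allI impI)
    fix x assume x: "S.MCauchy x"
    have cauchy: "\<exists>N. \<forall>n m. N \<le> n \<longrightarrow> N \<le> m \<longrightarrow> s.dist_g (x n) (x m) < e" if "e > 0" for e
      using x that unfolding S.MCauchy_def by blast
    show "\<exists>l. limitin S.mtopology x l sequentially"
    proof (cases "\<forall>e>0. \<forall>n. \<exists>m\<ge>n. \<exists>y\<in>K. s.dist_g (x m) y < e")
      case True
      then have "\<forall>k. \<exists>m y. m \<ge> k \<and> y \<in> K \<and> s.dist_g (x m) y < inverse (real (Suc k))"
        by (metis inverse_positive_iff_positive of_nat_0_less_iff zero_less_Suc)
      then obtain m y where my: "\<And>k. m k \<ge> k" "\<And>k. y k \<in> K"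
        "\<And>k. s.dist_g (x (m k)) (y k) < inverse (real (Suc k))"
        by metis
      \<comment> \<open>\<open>K\<close> is compact in the topology of the surface; agreement of the
        topologies turns this into sequential compactness for the distance of
        \<open>s\<close>.\<close>
      have "compactin S.mtopology K" using K s.mtopology_dist_g by simp
      moreover have "range y \<subseteq> K" using my by blast
      ultimately obtain l r where r: "strict_mono r" "limitin S.mtopology (y \<circ> r) l sequentially"
        unfolding S.compactin_sequentially by blast
      have "limitin S.mtopology x l sequentially"
        unfolding S.limit_metric_sequentially
      proof (intro conjI allI impI)
        fix e :: real assume e: "e > 0"
        obtain n0 where n0: "\<And>n m. n0 \<le> n \<Longrightarrow> n0 \<le> m \<Longrightarrow> s.dist_g (x n) (x m) < e/3"
          using cauchy[of "e/3"] e by auto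
        obtain n1 where n1: "\<And>n. n1 \<le> n \<Longrightarrow> s.dist_g (y (r n)) l < e/3"
          using r(2) e unfolding S.limit_metric_sequentially o_def
          by (metis divide_pos_pos zero_less_numeral)
        obtain n2 where n2: "inverse (real (Suc n2)) < e/3"
          using reals_Archimedean[of "e/3"] e by auto
        \<comment> \<open>A single index serves three estimates of size e/3: from \<open>x n\<close>
          to \<open>x (m (r k))\<close> by the Cauchy property, on to \<open>y (r k)\<close> in
          \<open>K\<close>, and on to \<open>l\<close>. The inequalities
          \<open>k \<le> r k \<le> m (r k)\<close> carry the thresholds through both
          selections.\<close>
        define k where "k = max n0 (max n1 n2)"
        have rk: "r k \<ge> k" using r(1) by (rule seq_suble)
        then have mk: "m (r k) \<ge> n0" using my(1)[of "r k"] by (simp add: k_def)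
        have "inverse (real (Suc (r k))) \<le> inverse (real (Suc n2))"
          using rk by (intro le_imp_inverse_le) (auto simp: k_def)
        then have 2: "s.dist_g (x (m (r k))) (y (r k)) < e/3" using my(3)[of "r k"] n2 by linarith
        have 3: "s.dist_g (y (r k)) l < e/3" by (rule n1) (simp add: k_def)
        show "\<exists>N. \<forall>n\<ge>N. x n \<in> UNIV \<and> s.dist_g (x n) l < e"
        proof (intro exI[of _ n0] allI impI conjI)
          fix n assume "n0 \<le> n"
          then have "s.dist_g (x n) (x (m (r k))) < e/3" using n0 mk by blast
          then show "s.dist_g (x n) l < e"
            using 2 3 S.triangle[of "x n" "x (m (r k))" "y (r k)"] S.triangle[of "x n" "y (r k)" l]
            by simp
        qed simp
      qed simp
      then show ?thesis by blast
    next
      case False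
      then obtain e n0 where e: "e > 0" and away: "\<And>m y. m \<ge> n0 \<Longrightarrow> y \<in> K \<Longrightarrow> e \<le> s.dist_g (x m) y"
        by (meson not_less)
      obtain n1 where n1: "\<And>n m. n1 \<le> n \<Longrightarrow> n1 \<le> m \<Longrightarrow> s.dist_g (x n) (x m) < 1"
        using cauchy[of 1] by auto
      \<comment> \<open>One unit covers the change of \<open>F\<close> from \<open>x n1\<close> to a
        later \<open>x n\<close>, the other its change along a connecting curve of length below
        1.\<close>
      define C where "C = norm (F (x n1)) + 2"
      have C: "C > 0" by (simp add: C_def add_nonneg_pos)
      have Fx: "norm (F (x n)) \<le> norm (F (x n1)) + 1" if n: "n \<ge> n1" for n
      proof -
        obtain \<gamma> where "piecewise_C1_curve A \<gamma>" "\<gamma> 0 = x n1" "\<gamma> 1 = x n" "curve_length A s \<gamma> < 1"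
          using s.dist_g_less[OF n1[OF order_refl n]] by blast
        then have "norm (F (x n) - F (x n1)) \<le> 1" using lipschitz[of \<gamma> 1] by simp
        then show ?thesis using norm_triangle_sub[of "F (x n)" "F (x n1)"] by linarith
      qed
      have "G.MCauchy x"
        unfolding G.MCauchy_def
      proof (intro conjI allI impI)
        fix \<epsilon> :: real assume \<epsilon>: "\<epsilon> > 0"
        \<comment> \<open>The bound \<open>e\<close> keeps the curve off \<open>K\<close>, the bound
          1 keeps \<open>norm (F (\<gamma> t))\<close> below \<open>C\<close>, and the last bound
          makes its length for \<open>g\<close> less than \<epsilon>.\<close>
        define \<delta> where "\<delta> = min (min e 1) (\<epsilon> / sqrt C)"
        have \<delta>: "\<delta> > 0" "\<delta> \<le> e" "\<delta> \<le> 1" "\<delta> \<le> \<epsilon> / sqrt C"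
          using e \<epsilon> C by (auto simp: \<delta>_def)
        from \<delta>(4) have \<delta>\<epsilon>: "sqrt C * \<delta> \<le> \<epsilon>" using C by (simp add: field_simps)
        obtain N where N: "\<And>n m. N \<le> n \<Longrightarrow> N \<le> m \<Longrightarrow> s.dist_g (x n) (x m) < \<delta>"
          using cauchy[OF \<delta>(1)] by blast
        have "g.dist_g (x n) (x m) < \<epsilon>" if nm: "max N (max n0 n1) \<le> n" "max N (max n0 n1) \<le> m" for n m
        proof -
          obtain \<gamma> where \<gamma>: "piecewise_C1_curve A \<gamma>" "\<gamma> 0 = x n" "\<gamma> 1 = x m" "curve_length A s \<gamma> < \<delta>"
            using s.dist_g_less[OF N[of n m]] nm by auto
          have "curve_length A g \<gamma> \<le> sqrt C * curve_length A s \<gamma>"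
          proof (rule curve_length_le_scaled[OF s g \<gamma>(1)])
            fix c t v assume t: "t \<in> {0..1}" and c: "c \<in> A" "\<gamma> t \<in> fst c"
            have "s.dist_g (x n) (\<gamma> t) < e"
              using s.dist_g_initial_le[OF \<gamma>(1) t] \<gamma> \<delta> by simp
            then have "\<gamma> t \<notin> K" using away[of n "\<gamma> t"] nm by auto
            then have "g c (\<gamma> t) v v \<le> norm (F (\<gamma> t)) * s c (\<gamma> t) v v" using le c by blast
            also have "norm (F (\<gamma> t)) \<le> C"
              using lipschitz[OF \<gamma>(1) t] norm_triangle_sub[of "F (\<gamma> t)" "F (x n)"] Fx[of n] nm \<gamma> \<delta>
              by (simp add: C_def)
            then have "norm (F (\<gamma> t)) * s c (\<gamma> t) v v \<le> C * s c (\<gamma> t) v v"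
              using s.g_nonneg[OF c] by (rule mult_right_mono)
            finally show "g c (\<gamma> t) v v \<le> C * s c (\<gamma> t) v v" .
          qed (use C in simp)
          also have "\<dots> < sqrt C * \<delta>" using \<gamma>(4) C by simp
          finally show ?thesis using g.dist_g_le[OF \<gamma>(1)] \<gamma> \<delta>\<epsilon> by simp
        qed
        then show "\<exists>N. \<forall>n n'. N \<le> n \<longrightarrow> N \<le> n' \<longrightarrow> g.dist_g (x n) (x n') < \<epsilon>" by blast
      qed simp
      then show ?thesis
        using complete unfolding G.mcomplete_def s.mtopology_dist_g g.mtopology_dist_g by blast
    qed
  qed
qed

section \<open>The first fundamental form\<close>

lemma Re_mult_cnj: "Re (v * cnj v) = (cmod v)\<^sup>2"
  by (metis Re_complex_of_real complex_norm_square)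

text \<open>Chain rule through a map between surfaces, used for transition maps
  (\<open>\<phi> = id\<close>) and for the covering projection. By \<open>ev\<close>,
  \<open>chart_inv c'\<close> undoes \<open>snd c'\<close> at all nearby image points.\<close>

lemma has_derivative_pullback:
  assumes c: "is_chart c" "p \<in> fst c" and c': "is_chart c'"
    and ev: "\<forall>\<^sub>F z in nhds (snd c p). \<phi> (chart_inv c z) \<in> fst c'"
    and \<phi>: "((snd c' \<circ> \<phi> \<circ> chart_inv c) has_field_derivative m) (at (snd c p))"
    and N: "((N \<circ> chart_inv c') has_derivative L) (at (snd c' (\<phi> p)))"
  shows "((N \<circ> \<phi> \<circ> chart_inv c) has_derivative (\<lambda>v. L (m * v))) (at (snd c p))"
proof -
  obtain U where U: "open U" "snd c p \<in> U" "\<And>z. z \<in> U \<Longrightarrow> \<phi> (chart_inv c z) \<in> fst c'"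
    using ev unfolding eventually_nhds by blast
  have D: "((N \<circ> chart_inv c' \<circ> (snd c' \<circ> \<phi> \<circ> chart_inv c)) has_derivative (\<lambda>v. L (m * v))) (at (snd c p))"
    using diff_chain_at[OF \<phi>[unfolded has_field_derivative_def], of "N \<circ> chart_inv c'" L] N c
    by (simp add: o_def)
  show ?thesis
    by (rule has_derivative_transform_within_open[OF D U(1,2)]) (use U(3) c' in simp)
qed

lemma conformal_has_derivative:
  assumes A: "riemann_surface A" and N: "conformal_minimal_immersion A N"
    and c: "c \<in> A" "p \<in> fst c"
  shows "((N \<circ> chart_inv c) has_derivative surface_deriv c N p) (at (snd c p))"
proof -
  have "Ck_on (Suc 0) (snd c ` fst c) (N \<circ> chart_inv c)"
    using N c unfolding conformal_minimal_immersion_def by blast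
  then have "(N \<circ> chart_inv c) differentiable (at (snd c p) within snd c ` fst c)"
    using c by (simp add: differentiable_on_def)
  then have "(N \<circ> chart_inv c) differentiable (at (snd c p))"
    using at_within_open[OF _ chart_open(2)[OF riemann_surface_chart[OF A c(1)]], of "snd c p"] c by simp
  then show ?thesis
    unfolding frechet_derivative_works surface_deriv_def[abs_def] .
qed

text \<open>Positivity comes from the conformal factor, continuity from the C1 part of the
  smoothness assumption, and the tensor law from uniqueness of the derivative of \<open>N\<close>
  computed in two charts.\<close>

lemma riemannian_metric_first_fundamental_form:
  assumes A: "riemann_surface A" and N: "conformal_minimal_immersion A N"
  shows "riemannian_metric A (first_fundamental_form N)"
proof -
  note D = conformal_has_derivative[OF A N]
  have bil: "bilinear (first_fundamental_form N c p)" if c: "c \<in> A" "p \<in> fst c" for c p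
  proof -
    have l: "linear (surface_deriv c N p)" using D[OF c] by (rule has_derivative_linear)
    then show ?thesis
      unfolding bilinear_def first_fundamental_form_def
      by (auto intro!: linearI simp: linear_add linear_cmul inner_add_left inner_add_right)
  qed
  have change: "surface_deriv c N p v = surface_deriv c' N p (map_deriv c c' id p * v)"
    if c: "c \<in> A" "p \<in> fst c" "c' \<in> A" "p \<in> fst c'" for c c' p v
  proof -
    note ch = riemann_surface_chart[OF A c(1)] riemann_surface_chart[OF A c(3)]
    have "\<forall>\<^sub>F z in nhds (snd c p). z \<in> snd c ` (fst c \<inter> fst c')"
      using transition_holomorphic(2)[OF A c(1,3)] c by (intro eventually_nhds_in_open) auto
    then have ev: "\<forall>\<^sub>F z in nhds (snd c p). id (chart_inv c z) \<in> fst c'"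
      by eventually_elim (use ch in auto)
    have "((N \<circ> id \<circ> chart_inv c) has_derivative (\<lambda>v. surface_deriv c' N p (map_deriv c c' id p * v)))
        (at (snd c p))"
    proof (rule has_derivative_pullback[OF ch(1) c(2) ch(2) ev])
      show "((snd c' \<circ> id \<circ> chart_inv c) has_field_derivative map_deriv c c' id p) (at (snd c p))"
        unfolding comp_id by (rule transition_has_derivative[OF A c(1,3,2,4)])
      show "((N \<circ> chart_inv c') has_derivative surface_deriv c' N p) (at (snd c' (id p)))"
        unfolding id_apply by (rule D[OF c(3,4)])
    qed
    then show ?thesis using has_derivative_unique[OF D[OF c(1,2)]] by (metis comp_id)
  qed
  have cont: "continuous_on (fst c) (\<lambda>p. first_fundamental_form N c p v w)" if c: "c \<in> A" for c v w
  proof -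
    have "continuous_on (fst c) (\<lambda>p. surface_deriv c N p v)" for v
    proof -
      have "Ck_on (Suc 0) (snd c ` fst c) (N \<circ> chart_inv c)"
        using N c unfolding conformal_minimal_immersion_def by blast
      then have "continuous_on (snd c ` fst c) (\<lambda>z. frechet_derivative (N \<circ> chart_inv c) (at z) v)"
        by simp
      then show ?thesis
        unfolding surface_deriv_def
        by (rule continuous_on_compose2[OF _ chart_continuous[OF riemann_surface_chart[OF A c]]]) simp
    qed
    then show ?thesis unfolding first_fundamental_form_def by (intro continuous_on_inner)
  qed
  have pos: "first_fundamental_form N c p v v > 0" if c: "c \<in> A" "p \<in> fst c" and v: "v \<noteq> 0" for c p v
  proof -
    obtain r where "r > 0" "\<And>v w. first_fundamental_form N c p v w = r * Re (v * cnj w)"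
      using N c unfolding conformal_minimal_immersion_def by blast
    then show ?thesis using v unfolding Re_mult_cnj by (simp only: Re_mult_cnj) simp
  qed
  have coords: "first_fundamental_form N c p v w =
      first_fundamental_form N c' p (map_deriv c c' id p * v) (map_deriv c c' id p * w)"
    if "c \<in> A" "c' \<in> A" "p \<in> fst c \<inter> fst c'" for c c' p v w
    using change[of c p c'] that unfolding first_fundamental_form_def by auto
  have tensor: "symmetric_tensor A (first_fundamental_form N)"
    unfolding symmetric_tensor_def
  proof (intro conjI ballI allI)
    show "first_fundamental_form N c p v w = first_fundamental_form N c p w v" for c p v w
      by (simp add: first_fundamental_form_def inner_commute)
  qed (fact bil coords)+
  show ?thesis
    unfolding riemannian_metric_def
    by (intro conjI ballI allI impI tensor) (fact cont pos)+
qed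

section \<open>The affine metric in terms of the conormal map\<close>

lemma Im_det3_cvec:
  "Im (det3 (cvec n) P (vcnj P)) = - 2 * (n \<bullet> cross3 (\<chi> i. Re (P $ i)) (\<chi> i. Im (P $ i)))"
proof -
  define a1 a2 a3 b1 b2 b3 where "a1 = Re (P $ 1)" "a2 = Re (P $ 2)" "a3 = Re (P $ 3)"
    "b1 = Im (P $ 1)" "b2 = Im (P $ 2)" "b3 = Im (P $ 3)"
  note ab = this
  \<comment> \<open>The determinant is the product of \<open>n\<close> with P x cnj P, and for P = a
    + i b that cross product equals -2i (a x b).\<close>
  have "det3 (cvec n) P (vcnj P) =
      n $ 1 * (P $ 2 * cnj (P $ 3) - P $ 3 * cnj (P $ 2))
    + n $ 2 * (P $ 3 * cnj (P $ 1) - P $ 1 * cnj (P $ 3))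
    + n $ 3 * (P $ 1 * cnj (P $ 2) - P $ 2 * cnj (P $ 1))"
    unfolding det3_def det_3 by (simp only: vector_3 cvec_def vcnj_def vec_lambda_beta) algebra
  also have "Im \<dots> = n $ 1 * (2 * (b2 * a3 - a2 * b3)) + n $ 2 * (2 * (b3 * a1 - a3 * b1))
      + n $ 3 * (2 * (b1 * a2 - a1 * b2))"
    by (simp only: ab plus_complex.sel minus_complex.sel times_complex.sel complex_cnj
        Re_complex_of_real Im_complex_of_real cnj.sel) algebra
  also have "\<dots> = - 2 * (n \<bullet> cross3 (\<chi> i. Re (P $ i)) (\<chi> i. Im (P $ i)))"
    unfolding cross3_def inner_vec_def sum_3 by (simp only: vector_3 vec_lambda_beta inner_real_def ab) algebra
  finally show ?thesis .
qed

text \<open>The prefactor acts by Re (-2i z) = 2 Im z, which turns the -2 of the determinant into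
  -4.\<close>

lemma Re_affine_coeff:
  assumes "cvec n = \<Phi> x + vcnj (\<Phi> x)"
  shows "Re (affine_coeff c \<Phi> x) =
    - 4 * (n \<bullet> cross3 (\<chi> i. Re (C3_deriv c \<Phi> x $ i)) (\<chi> i. Im (C3_deriv c \<Phi> x $ i)))"
  using Im_det3_cvec[of n "C3_deriv c \<Phi> x"] by (simp add: affine_coeff_def assms[symmetric])
text \<open>Upstairs \<open>N\<close> lifts to 2 Re \<Phi>, whose coordinate derivatives are 2a and
  -2b for \<Phi>_z = a + i b. Conformality gives 4|a|^2 = 4|b|^2 = r |m|^2, where \<open>m\<close>
  is the derivative of the projection, so 4 |<N, a x b>| is at most |N| r |m|^2; the factor |m|^2
  disappears on passing down to the surface.\<close>

lemma abs_affine_metric_le: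
  assumes A: "riemann_surface A" and cover: "universal_cover A B \<pi>"
    and max: "affine_maxface A B \<pi> \<Phi> N \<psi>" and h: "is_affine_metric A B \<pi> \<Phi> h"
    and c': "c' \<in> A" and p: "p \<in> fst c'"
    and r: "\<And>v w. first_fundamental_form N c' p v w = r * Re (v * cnj w)"
  shows "\<bar>h c' p 1 1\<bar> \<le> norm (N p) * r"
proof -
  have B: "riemann_surface B" and cov: "covering_space UNIV \<pi> UNIV" and hol: "holomorphic_map B A \<pi>"
    using cover unfolding universal_cover_def by auto
  have conf: "conformal_minimal_immersion A N" and holC: "holomorphic_C3 B \<Phi>"
    and N\<Phi>: "\<And>x. cvec (N (\<pi> x)) = \<Phi> x + vcnj (\<Phi> x)"
    using max unfolding affine_maxface_def affine_maximal_map_def by auto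
  obtain x where x: "\<pi> x = p" using covering_space_imp_surjective[OF cov] by (metis UNIV_I imageE)
  obtain c where c: "c \<in> B" "x \<in> fst c" using riemann_surface_cover[OF B] by blast
  note ch = riemann_surface_chart[OF B c(1)] and ch' = riemann_surface_chart[OF A c']
  \<comment> \<open>Injectivity of the projection on a sheet, together with holomorphy, forces its
    coordinate derivative \<open>m\<close> to be nonzero. This is needed because \<open>h\<close> is
    prescribed only on vectors of the form m v.\<close>
  obtain T where T: "x \<in> T" "open T" "inj_on \<pi> T"
  proof -
    obtain T u q where "x \<in> T" "openin (top_of_set UNIV) T" "homeomorphism T u \<pi> q"
      using covering_space_local_homeomorphism[OF cov UNIV_I[of x]] by metis
    then show ?thesis
      using that unfolding homeomorphism_def by (metis inj_on_inverseI open_openin subtopology_UNIV)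
  qed
  let ?f = "snd c' \<circ> \<pi> \<circ> chart_inv c"
  have cont: "continuous_on UNIV \<pi>" and f: "?f holomorphic_on snd c ` (fst c \<inter> \<pi> -` fst c')"
    using hol c c' unfolding holomorphic_map_def by auto
  define W where "W = fst c \<inter> \<pi> -` fst c' \<inter> T"
  have "open (\<pi> -` fst c')" using cont chart_open(1)[OF ch'] by (rule open_vimage[rotated])
  then have W: "open (snd c ` W)" "snd c x \<in> snd c ` W"
    using chart_open(1)[OF ch] T c p x by (auto simp: W_def intro!: open_chart_image[OF ch])
  have fW: "?f holomorphic_on snd c ` W"
    by (rule holomorphic_on_subset[OF f]) (auto simp: W_def)
  have "inj_on ?f (snd c ` W)"
  proof (rule inj_onI)
    fix y z assume "y \<in> snd c ` W" "z \<in> snd c ` W" and eq: "?f y = ?f z"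
    then obtain p q where pq: "p \<in> W" "q \<in> W" "y = snd c p" "z = snd c q" by blast
    then have "snd c' (\<pi> p) = snd c' (\<pi> q)" using eq ch by (simp add: W_def)
    then have "\<pi> p = \<pi> q" using pq chart_inv_chart[OF ch'] by (metis IntD1 IntD2 W_def vimageD)
    then show "y = z" using pq T(3) by (auto simp: W_def inj_on_def)
  qed
  define m where "m = map_deriv c c' \<pi> x"
  have m: "m \<noteq> 0"
    unfolding m_def map_deriv_def by (rule holomorphic_injective_imp_regular[OF fW W(1) _ W(2)]) fact
  have df: "(?f has_field_derivative m) (at (snd c x))"
    unfolding m_def map_deriv_def by (rule holomorphic_derivI[OF fW W])
  let ?L = "surface_deriv c' N p"
  have "\<forall>\<^sub>F z in nhds (snd c x). z \<in> snd c ` W" by (rule eventually_nhds_in_open[OF W])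
  then have ev: "\<forall>\<^sub>F z in nhds (snd c x). \<pi> (chart_inv c z) \<in> fst c'"
    by eventually_elim (use ch in \<open>auto simp: W_def\<close>)
  have D1: "((N \<circ> \<pi> \<circ> chart_inv c) has_derivative (\<lambda>v. ?L (m * v))) (at (snd c x))"
    by (rule has_derivative_pullback[OF ch c(2) ch' ev df])
      (unfold x, rule conformal_has_derivative[OF A conf c' p])
  define P where "P = C3_deriv c \<Phi> x"
  have N\<Phi>': "N (\<pi> y) $ i = 2 * Re (\<Phi> y $ i)" for y i
    using arg_cong[OF N\<Phi>[of y], of "\<lambda>v. Re (v $ i)"] by (simp add: cvec_def vcnj_def)
  \<comment> \<open>The derivative of the lifted conormal map is computed twice, by the chain rule
    through \<pi> and from N = 2 Re \<Phi>; uniqueness identifies the results.\<close>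
  have L: "?L (m * v) $ i = 2 * Re (P $ i * v)" for v i
  proof -
    have "(\<lambda>z. \<Phi> (chart_inv c z) $ i) holomorphic_on snd c ` fst c"
      using holC c unfolding holomorphic_C3_def by blast
    from holomorphic_derivI[OF this chart_open(2)[OF ch], of "snd c x"] c
    have "((\<lambda>z. \<Phi> (chart_inv c z) $ i) has_derivative (\<lambda>v. P $ i * v)) (at (snd c x))"
      by (simp add: has_field_derivative_def P_def C3_deriv_def)
    from has_derivative_mult_right[OF bounded_linear.has_derivative[OF bounded_linear_Re this], of 2]
    have "((\<lambda>z. N (\<pi> (chart_inv c z)) $ i) has_derivative (\<lambda>v. 2 * Re (P $ i * v))) (at (snd c x))"
      by (simp only: N\<Phi>')
    moreover have "((\<lambda>z. N (\<pi> (chart_inv c z)) $ i) has_derivative (\<lambda>v. ?L (m * v) $ i)) (at (snd c x))"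
      using bounded_linear.has_derivative[OF bounded_linear_vec_nth D1, of i] by (simp add: o_def)
    ultimately show ?thesis using has_derivative_unique by metis
  qed
  define a b where "a = (\<chi> i. Re (P $ i))" and "b = (\<chi> i. Im (P $ i))"
  have Lab: "?L (m * 1) = 2 *\<^sub>R a" "?L (m * \<i>) = (- 2) *\<^sub>R b"
    by (simp_all only: vec_eq_iff L) (simp_all add: a_def b_def)
  have "?L (m * v) \<bullet> ?L (m * v) = r * (cmod m)\<^sup>2 * (cmod v)\<^sup>2" for v
    using r[of "m * v" "m * v"] unfolding first_fundamental_form_def Re_mult_cnj
    by (simp add: norm_mult power_mult_distrib)
  from this[of 1] this[of \<i>] have "4 * (norm a)\<^sup>2 = r * (cmod m)\<^sup>2" "4 * (norm b)\<^sup>2 = r * (cmod m)\<^sup>2"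
    unfolding Lab by (simp_all add: power2_norm_eq_inner)
  note ab = this
  then have "(norm a)\<^sup>2 = (norm b)\<^sup>2" by linarith
  then have ab': "norm a = norm b" by (rule power2_eq_imp_eq) simp_all
  \<comment> \<open>The vector 1/m upstairs projects to the coordinate vector 1, at which the
    component of \<open>h\<close> is wanted.\<close>
  have "h c' p (m * (1 / m)) (m * (1 / m)) = Re (affine_coeff c \<Phi> x) * Re ((1 / m) * cnj (1 / m))"
    using h c c' p x unfolding is_affine_metric_def m_def by blast
  then have "h c' p 1 1 = Re (affine_coeff c \<Phi> x) / (cmod m)\<^sup>2"
    using m unfolding Re_mult_cnj by (simp add: norm_divide power_divide)
  also have "Re (affine_coeff c \<Phi> x) = - 4 * (N p \<bullet> cross3 a b)"
    using Re_affine_coeff[of "N p" \<Phi> x c] N\<Phi>[of x] x unfolding a_def b_def P_def by simp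
  finally have "\<bar>h c' p 1 1\<bar> = 4 * \<bar>N p \<bullet> cross3 a b\<bar> / (cmod m)\<^sup>2" by (simp add: abs_mult)
  also have "\<bar>N p \<bullet> cross3 a b\<bar> \<le> norm (N p) * (norm a * norm b)"
  proof -
    \<comment> \<open>Lagrange's identity: |a x b|^2 + (a . b)^2 = |a|^2 |b|^2.\<close>
    have "(norm (cross3 a b))\<^sup>2 \<le> (norm a * norm b)\<^sup>2"
      using norm_cross_dot[of a b] zero_le_power2[of "a \<bullet> b"] by linarith
    then have "norm (cross3 a b) \<le> norm a * norm b" by (rule power2_le_imp_le) simp
    then show ?thesis
      using Cauchy_Schwarz_ineq2[of "N p" "cross3 a b"] by (meson mult_left_mono norm_ge_zero order_trans)
  qed
  then have "4 * \<bar>N p \<bullet> cross3 a b\<bar> / (cmod m)\<^sup>2 \<le> 4 * (norm (N p) * (norm a * norm b)) / (cmod m)\<^sup>2"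
    by (intro divide_right_mono) auto
  also have "\<dots> = norm (N p) * (4 * (norm a)\<^sup>2) / (cmod m)\<^sup>2"
    using ab' by (simp add: power2_eq_square)
  also have "\<dots> = norm (N p) * r" unfolding ab(1) using m by simp
  finally show ?thesis .
qed

theorem lemma5p1:
  fixes A :: "'a::t2_space chart set"
    and B :: "'b::t2_space chart set"
    and \<pi> :: "'b \<Rightarrow> 'a"
    and \<Phi> :: "'b \<Rightarrow> complex^3"
    and N \<psi> :: "'a \<Rightarrow> real^3"
  assumes "riemann_surface A"
    and "universal_cover A B \<pi>"
    and "affine_maxface A B \<pi> \<Phi> N \<psi>"
    and "complete_affine_map A B \<pi> \<Phi>"
  shows "complete_riemannian_metric A (first_fundamental_form N)"
proof -
  have conf: "conformal_minimal_immersion A N"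
    using assms(3) unfolding affine_maxface_def by blast
  note metric = riemannian_metric_first_fundamental_form[OF assms(1) conf]
  obtain h T where h: "is_affine_metric A B \<pi> \<Phi> h" and T: "compactly_supported A T"
    and g: "complete_riemannian_metric A (\<lambda>c p v w. abs_tensor h c p v w + T c p v w)"
    using assms(4) unfolding complete_affine_map_def by blast
  \<comment> \<open>Off this compact set \<open>T\<close> vanishes and the complete metric is |h|
    itself, to which the bound by |N| applies.\<close>
  define K where "K = closure {p. \<exists>c\<in>A. p \<in> fst c \<and> (\<exists>v w. T c p v w \<noteq> 0)}"
  have T0: "T c p v v = 0" if "c \<in> A" "p \<in> fst c" "p \<notin> K" for c p v
  proof (rule ccontr)
    assume "T c p v v \<noteq> 0"
    then have "p \<in> {p. \<exists>c\<in>A. p \<in> fst c \<and> (\<exists>v w. T c p v w \<noteq> 0)}" using that by blast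
    then have "p \<in> K" unfolding K_def by (rule subsetD[OF closure_subset])
    with that(3) show False by blast
  qed
  have le: "abs_tensor h c p v v + T c p v v \<le> norm (N p) * first_fundamental_form N c p v v"
    if c: "c \<in> A" "p \<in> fst c" "p \<notin> K" for c p v
  proof -
    obtain r where r: "\<And>v w. first_fundamental_form N c p v w = r * Re (v * cnj w)"
      using conf c unfolding conformal_minimal_immersion_def by blast
    have "\<bar>h c p 1 1\<bar> * Re (v * cnj v) \<le> norm (N p) * r * Re (v * cnj v)"
      by (intro mult_right_mono abs_affine_metric_le[OF assms(1-3) h c(1,2) r])
        (simp only: Re_mult_cnj zero_le_power2)
    then show ?thesis using T0[OF c] r[of v v] by (simp only: abs_tensor_def mult.assoc add_0_right)
  qed
  have "Metric_space.mcomplete UNIV (riemannian_dist A (first_fundamental_form N))"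
  proof (rule complete_comparison[OF _ _ _ conformal_has_derivative[OF assms(1) conf]])
    show "riemannian_surface A (first_fundamental_form N)"
      by unfold_locales (fact assms(1), fact metric)
    show "riemannian_surface A (\<lambda>c p v w. abs_tensor h c p v w + T c p v w)"
      using assms(1) g unfolding complete_riemannian_metric_def by unfold_locales auto
    show "Metric_space.mcomplete UNIV (riemannian_dist A (\<lambda>c p v w. abs_tensor h c p v w + T c p v w))"
      using g unfolding complete_riemannian_metric_def by blast
    show "compact K" using T unfolding compactly_supported_def K_def .
    \<comment> \<open>Equality holds: the first fundamental form is the Euclidean metric pulled back
      by \<open>N\<close>, which is the source of the Lipschitz constant 1.\<close>
    show "norm (surface_deriv c N p v) \<le> sqrt (first_fundamental_form N c p v v)" for c p v
      by (simp add: first_fundamental_form_def norm_eq_sqrt_inner)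
  qed (use le in auto)
  with metric show ?thesis unfolding complete_riemannian_metric_def by blast
qed

end
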